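(* Let $(\mathcal{F}_n)_{n\ge1}$ be a decreasing sequence of $\sigma$-algebras on a probability space, and let $Z_n$ be an $\mathcal{F}_n$-measurable square-integrable random variable such that $E(Z_n|\mathcal{F}_{n+1})=0$, for each $n\ge1$. Let $B_n>0$ increase to infinity, let $\zeta$ be a non-negative random variable, and let $b_k\in[0,\infty)$ be a bounded sequence with $\sum b_k=+\infty$. Assume that: 1. Almost surely, $Z_n/B_n\to0$. 2. For almost all $\omega$, the measures $\frac{1}{\sum_{k=1}^nb_k}\sum_{k=1}^nb_k\,\delta_{\sum_{j=1}^kZ_j^2(\omega)/B_k^2}$ converge weakly to $\delta_{\zeta(\omega)}$ as $n\to\infty$. 3. The sequence $b_k$ satisfies $b_k=O\left(\frac{B_k-B_{k-1}}{B_k}\right)$. 4. $\sup_kE\left[\max_{1\le j\le k}|Z_j|^2/B_k^2\right]<\infty$. Then, for almost all $\omega$, the measures $$\frac{1}{\sum_{k=1}^nb_k}\sum_{k=1}^nb_k\,\delta_{\sum_{j=1}^kZ_j(\omega)/B_k}$$ on $\mathbb{R}$ converge weakly to $\mathcal{N}(0,\zeta(\omega))$ as $n\to\infty$.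
   Context: $\delta_x$ is the Dirac mass at $x\in\mathbb{R}$; $\mathcal{N}(0,v)$ is the centered Gaussian law of variance $v$ (the Dirac mass at $0$ if $v=0$). *)

theory Defs
  imports "HOL-Probability.Probability" "HOL-Library.Landau_Symbols"
begin

text \<open>The measure \<open>(1 / (b 1 + \<dots> + b n)) * (b 1 * \<delta>\<^bsub>x 1\<^esub> + \<dots> + b n * \<delta>\<^bsub>x n\<^esub>)\<close> on the real line.
  Sequences are indexed from 1. If the weights sum to zero, the factor \<open>1 / 0 = 0\<close> makes this
  the zero measure.\<close>

definition weighted_dirac_average ::
  "(nat \<Rightarrow> real) \<Rightarrow> (nat \<Rightarrow> real) \<Rightarrow> nat \<Rightarrow> real measure" where
  "weighted_dirac_average b x n =
     scale_measure (ennreal (1 / (\<Sum>k=1..n. b k)))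
       (measure_of UNIV (sets borel)
         (\<lambda>A. \<Sum>k=1..n. ennreal (b k) * emeasure (return borel (x k)) A))"

lemma space_weighted_dirac_average [simp]: "space (weighted_dirac_average b x n) = UNIV"
  by (simp add: weighted_dirac_average_def space_scale_measure space_measure_of_conv)

lemma sets_weighted_dirac_average [simp, measurable_cong]:
  "sets (weighted_dirac_average b x n) = sets borel"
proof -
  have "sigma_sets UNIV (sets borel) = sets (borel :: real measure)"
    by (metis sets.sigma_sets_eq space_borel)
  then show ?thesis
    by (simp add: weighted_dirac_average_def)
qed

text \<open>\<^const>\<open>measure_of\<close> yields the zero measure when its argument is not countably additive;
  the following shows that this does not happen here.\<close>

lemma emeasure_weighted_dirac_average:
  assumes "A \<in> sets borel"
  shows "emeasure (weighted_dirac_average b x n) A =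
    ennreal (1 / (\<Sum>k=1..n. b k)) * (\<Sum>k=1..n. ennreal (b k) * indicator A (x k))"
proof -
  let ?f = "\<lambda>A. \<Sum>k=1..n. ennreal (b k) * emeasure (return borel (x k)) A"
  have "emeasure (measure_of UNIV (sets borel) ?f) A = ?f A"
  proof (rule emeasure_measure_of[OF refl])
    show "positive (sets (measure_of UNIV (sets borel) ?f)) ?f"
      by (simp add: positive_def)
    show "countably_additive (sets (measure_of UNIV (sets borel) ?f)) ?f"
    proof (rule countably_additiveI)
      fix D :: "nat \<Rightarrow> real set"
      assume "range D \<subseteq> sets (measure_of UNIV (sets borel) ?f)" "disjoint_family D"
      moreover have "sigma_sets UNIV (sets borel) = sets (borel :: real measure)"
        by (metis sets.sigma_sets_eq space_borel)
      ultimately have D: "range D \<subseteq> sets (return borel y)" "disjoint_family D" for y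
        by simp_all
      have "(\<Sum>i. ?f (D i)) = (\<Sum>k=1..n. \<Sum>i. ennreal (b k) * emeasure (return borel (x k)) (D i))"
        by (rule suminf_sum) simp
      also have "\<dots> = ?f (\<Union>i. D i)"
        by (simp only: ennreal_suminf_cmult suminf_emeasure[OF D])
      finally show "(\<Sum>i. ?f (D i)) = ?f (\<Union>i. D i)" .
    qed
  qed (use assms in auto)
  with assms show ?thesis
    by (simp add: weighted_dirac_average_def)
qed

text \<open>The law \<open>N(0, v)\<close> for \<open>v \<ge> 0\<close>. The second parameter of \<^const>\<open>normal_density\<close> is the
  standard deviation, not the variance.\<close>

definition centered_normal :: "real \<Rightarrow> real measure" where
  "centered_normal v =
     (if v = 0 then return borel 0 else density lborel (\<lambda>x. ennreal (normal_density 0 (sqrt v) x)))"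

end

theory Submission
  imports Defs
begin

text \<open>Fix \<open>t\<close> and \<open>A > 0\<close> and write \<open>S\<^sub>k = Z\<^sub>1 + \<dots> + Z\<^sub>k\<close>, \<open>V\<^sub>k = Z\<^sub>1\<^sup>2 + \<dots> + Z\<^sub>k\<^sup>2\<close>. Following McLeish,
  \<open>e\<^bsup>itS\<^sub>k/B\<^sub>k\<^esup>\<close> is close to \<open>e\<^bsup>-t\<^sup>2V\<^sub>k/(2B\<^sub>k\<^sup>2)\<^esup> \<Prod>\<^sub>j (1 + itZ\<^sub>j/B\<^sub>k)\<close>, and for most \<open>k\<close> the first factor is close to
  \<open>e\<^bsup>-t\<^sup>2\<zeta>/2\<^esup>\<close>. So it suffices that the products average to \<open>1\<close> almost surely. They are built from \<open>j = k\<close>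
  downwards, which is the direction in which the \<open>Z\<^sub>j\<close> are martingale differences, and stopped as soon
  as \<open>Z\<^sub>k\<^sup>2 + \<dots> + Z\<^bsub>j+1\<^esub>\<^sup>2\<close> exceeds \<open>A B\<^sub>k\<^sup>2\<close>; this does not affect most \<open>k\<close> when \<open>A > \<zeta>\<close>. If \<open>Y\<^sub>k\<close> is the
  stopped product minus \<open>1\<close>, orthogonality and the maximal moment bound give
  \<open>Re E (Y\<^sub>k Y\<^sub>l\<^sup>*) \<le> K B\<^sub>l/B\<^sub>k\<close> for \<open>l \<le> k\<close>. As \<open>b\<^sub>l B\<^sub>l = O(B\<^sub>l - B\<^bsub>l-1\<^esub>)\<close>, the second moment of \<open>\<Sum>\<^bsub>k\<le>n\<^esub> b\<^sub>k Y\<^sub>k\<close> is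
  \<open>O(\<Sum>\<^bsub>k\<le>n\<^esub> b\<^sub>k)\<close>, which yields a strong law along a subsequence and then, since \<open>Y\<^sub>k\<close> is bounded along
  almost every path, for all \<open>n\<close>. By Fubini, almost surely the characteristic functions converge at
  almost every \<open>t\<close>, which is enough for weak convergence.\<close>

subsection \<open>Characteristic functions and weighted Dirac averages\<close>

text \<open>The squared modulus of \<open>iexp (t * x) - iexp (s * x)\<close> is
  \<open>2 * (1 - cos ((t - s) * x))\<close>. Cauchy-Schwarz, obtained from nonnegativity of a
  variance, then gives the bound.\<close>

lemma (in real_distribution) char_increment_bound:
  "(cmod (char M t - char M s))\<^sup>2 \<le> 2 * (1 - Re (char M (t - s)))"
proof -
  have int: "integrable M (\<lambda>x. iexp (u * x))" for u
    by (rule integrable_iexp) auto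
  have sq: "(cmod (iexp (t * x) - iexp (s * x)))\<^sup>2 = 2 * (1 - Re (iexp ((t - s) * x)))" for x
    by (simp add: cmod_power2 Re_exp Im_exp power2_diff left_diff_distrib cos_diff)
      (use sin_cos_squared_add[of "t * x"] sin_cos_squared_add[of "s * x"] in algebra)
  have int2: "integrable M (\<lambda>x. (cmod (iexp (t * x) - iexp (s * x)))\<^sup>2)"
    by (subst sq) (use int[of "t - s"] in \<open>auto intro!: integrable_Re\<close>)
  have int1: "integrable M (\<lambda>x. cmod (iexp (t * x) - iexp (s * x)))"
    using int by (intro integrable_norm Bochner_Integration.integrable_diff)
  have "cmod (char M t - char M s) = cmod (\<integral>x. iexp (t * x) - iexp (s * x) \<partial>M)"
    unfolding char_def using int by simp
  also have "\<dots> \<le> expectation (\<lambda>x. cmod (iexp (t * x) - iexp (s * x)))"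
    by (rule integral_norm_bound)
  finally have "(cmod (char M t - char M s))\<^sup>2 \<le> (expectation (\<lambda>x. cmod (iexp (t * x) - iexp (s * x))))\<^sup>2"
    by (intro power_mono) auto
  also have "\<dots> \<le> expectation (\<lambda>x. (cmod (iexp (t * x) - iexp (s * x)))\<^sup>2)"
    using variance_eq[OF int1 int2] variance_positive[of "\<lambda>x. cmod (iexp (t * x) - iexp (s * x))"]
    by linarith
  also have "\<dots> = 2 * (1 - Re (char M (t - s)))"
    unfolding sq char_def using int[of "t - s"] prob_space by simp
  finally show ?thesis .
qed

text \<open>Given \<open>t\<close>, some small \<open>h\<close> is such that both \<open>h\<close> and \<open>t + h\<close> are outside the exceptional null set;
  convergence at \<open>h\<close> controls the increments between \<open>t\<close> and \<open>t + h\<close>.\<close>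

theorem levy_continuity_AE:
  fixes \<mu> :: "nat \<Rightarrow> real measure" and \<nu> :: "real measure"
  assumes \<mu>: "\<And>n. real_distribution (\<mu> n)" and \<nu>: "real_distribution \<nu>"
    and conv: "AE t in lborel. (\<lambda>n. char (\<mu> n) t) \<longlonglongrightarrow> char \<nu> t"
  shows "weak_conv_m \<mu> \<nu>"
proof (rule levy_continuity[OF \<mu> \<nu>])
  fix t :: real
  interpret \<nu>: real_distribution \<nu> by fact
  have conv_t: "AE h in lborel. (\<lambda>n. char (\<mu> n) (t + h)) \<longlonglongrightarrow> char \<nu> (t + h)"
  proof -
    \<comment> \<open>Lebesgue measure is translation invariant, so the exceptional set shifted by
      \<open>t\<close> is again null.\<close>
    have "AE s in distr lborel borel ((+) t). (\<lambda>n. char (\<mu> n) s) \<longlonglongrightarrow> char \<nu> s"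
      by (subst lborel_distr_plus) (rule conv)
    then show ?thesis
      by (rule AE_distrD[rotated]) simp
  qed
  show "(\<lambda>n. char (\<mu> n) t) \<longlonglongrightarrow> char \<nu> t"
  proof (rule LIMSEQ_I)
    fix e :: real assume e: "e > 0"
    have "((\<lambda>h. 2 * (1 - Re (char \<nu> h))) \<longlongrightarrow> 2 * (1 - Re (char \<nu> 0))) (at_right 0)"
      using \<nu>.isCont_char[of 0] unfolding isCont_def
      by (intro tendsto_intros) (auto intro: tendsto_mono[OF at_le])
    then have E1: "\<forall>\<^sub>F h in at_right 0. 2 * (1 - Re (char \<nu> h)) < (e/3)\<^sup>2"
      using e by (intro order_tendstoD(2)) (auto simp: \<nu>.char_zero)
    have "isCont (\<lambda>h. char \<nu> (t + h)) 0"
      by (rule isCont_o2[OF _ \<nu>.isCont_char]) (auto intro!: continuous_intros)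
    then have "((\<lambda>h. char \<nu> (t + h)) \<longlongrightarrow> char \<nu> t) (at_right 0)"
      unfolding isCont_def by (auto intro: tendsto_mono[OF at_le])
    then have E2: "\<forall>\<^sub>F h in at_right 0. dist (char \<nu> (t + h)) (char \<nu> t) < e/3"
      using e by (intro tendstoD) auto
    from eventually_conj[OF E1 E2] obtain d :: real where d: "d > 0" and
      close: "\<And>h. 0 < h \<Longrightarrow> h < d \<Longrightarrow> 2 * (1 - Re (char \<nu> h)) < (e/3)\<^sup>2 \<and> dist (char \<nu> (t + h)) (char \<nu> t) < e/3"
      unfolding eventually_at_right_field by auto
    \<comment> \<open>Otherwise two null sets would cover \<open>{0<..<d}\<close>, which has
      positive length.\<close>
    have "\<exists>h. 0 < h \<and> h < d \<and> (\<lambda>n. char (\<mu> n) h) \<longlonglongrightarrow> char \<nu> h \<and>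
        (\<lambda>n. char (\<mu> n) (t + h)) \<longlonglongrightarrow> char \<nu> (t + h)"
    proof (rule ccontr)
      assume neg: "\<not> ?thesis"
      have "AE h in lborel. h \<notin> {0<..<d}"
        using conv conv_t by eventually_elim (use neg in auto)
      then have "emeasure lborel {0<..<d} = 0"
        by (subst (asm) AE_iff_measurable[of "{0<..<d}"]) auto
      then show False using d by simp
    qed
    then obtain h where h: "0 < h" "h < d" "(\<lambda>n. char (\<mu> n) h) \<longlonglongrightarrow> char \<nu> h"
        "(\<lambda>n. char (\<mu> n) (t + h)) \<longlonglongrightarrow> char \<nu> (t + h)"
      by blast
    have "(\<lambda>n. 2 * (1 - Re (char (\<mu> n) h))) \<longlonglongrightarrow> 2 * (1 - Re (char \<nu> h))"
      by (intro tendsto_intros h)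
    then have F1: "\<forall>\<^sub>F n in sequentially. 2 * (1 - Re (char (\<mu> n) h)) < (e/3)\<^sup>2"
      using close[of h] h by (intro order_tendstoD(2)) auto
    have F2: "\<forall>\<^sub>F n in sequentially. dist (char (\<mu> n) (t + h)) (char \<nu> (t + h)) < e/3"
      using e by (intro tendstoD h) auto
    from eventually_conj[OF F1 F2] have "\<forall>\<^sub>F n in sequentially. norm (char (\<mu> n) t - char \<nu> t) < e"
    proof eventually_elim
      case (elim n)
      \<comment> \<open>The increment is controlled by \<open>char (\<mu> n) h\<close>, where
        convergence is known, although \<open>t\<close> itself may be exceptional.\<close>
      have "(cmod (char (\<mu> n) (t + h) - char (\<mu> n) t))\<^sup>2 < (e/3)\<^sup>2"
        using real_distribution.char_increment_bound[OF \<mu>, of n "t + h" t] elim by simp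
      then have "cmod (char (\<mu> n) (t + h) - char (\<mu> n) t) < e/3"
        by (rule power_less_imp_less_base) (use e in simp)
      then have "dist (char (\<mu> n) t) (char (\<mu> n) (t + h)) < e/3"
        by (simp add: dist_norm norm_minus_commute)
      with elim close[of h] h show ?case
        using dist_triangle[of "char (\<mu> n) t" "char \<nu> t" "char (\<mu> n) (t + h)"]
          dist_triangle[of "char (\<mu> n) (t + h)" "char \<nu> t" "char \<nu> (t + h)"]
        unfolding dist_norm[symmetric] by linarith
    qed
    then show "\<exists>no. \<forall>n\<ge>no. norm (char (\<mu> n) t - char \<nu> t) < e"
      by (simp add: eventually_sequentially)
  qed
qed

section \<open>Centered normal laws and integrals against weighted Dirac averages\<close>

lemma real_distribution_centered_normal:
  assumes "v \<ge> 0"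
  shows "real_distribution (centered_normal v)"
proof (cases "v = 0")
  case True
  then show ?thesis
    by (auto simp: centered_normal_def real_distribution_def real_distribution_axioms_def
        intro: prob_space_return)
next
  case False
  with assms show ?thesis
    by (auto simp: centered_normal_def real_distribution_def real_distribution_axioms_def
        intro: prob_space_normal_density)
qed

text \<open>For \<open>v > 0\<close> the law is the image of the standard normal law under
  multiplication by \<open>sqrt v\<close>; for \<open>v = 0\<close> both sides are
  \<open>1\<close>.\<close>

lemma char_centered_normal:
  assumes "v \<ge> 0"
  shows "char (centered_normal v) t = of_real (exp (- (t\<^sup>2 * v / 2)))"
proof (cases "v = 0")
  case True
  then show ?thesis by (simp add: centered_normal_def char_def integral_return)
next
  case False
  with assms have v: "v > 0" by simp
  interpret N: real_distribution std_normal_distribution by (rule real_dist_normal_dist)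
  have "distributed std_normal_distribution lborel (\<lambda>x. x) std_normal_density"
    by (auto simp: distributed_def intro!: measure_eqI simp: emeasure_distr)
  from N.normal_density_affine[OF this, of "sqrt v" 0] v
  have "distributed std_normal_distribution lborel (\<lambda>x. sqrt v * x) (normal_density 0 (sqrt v))"
    by simp
  then have "centered_normal v = distr std_normal_distribution lborel (\<lambda>x. sqrt v * x)"
    using v by (simp add: centered_normal_def distributed_def)
  then have "char (centered_normal v) t = char std_normal_distribution (sqrt v * t)"
    by (simp add: char_def integral_distr mult_ac)
  then show ?thesis
    using v by (simp add: char_std_normal_distribution power_mult_distrib mult.commute)
qed

lemma emeasure_weighted_dirac_average_UNIV:
  assumes "(\<Sum>k=1..n. b k) > 0" "\<And>k. k \<ge> 1 \<Longrightarrow> b k \<ge> 0"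
  shows "emeasure (weighted_dirac_average b x n) UNIV = 1"
proof -
  have "(\<Sum>k=1..n. ennreal (b k)) = ennreal (\<Sum>k=1..n. b k)"
    using assms by (intro sum_ennreal) auto
  then show ?thesis
    using assms by (simp add: emeasure_weighted_dirac_average ennreal_mult[symmetric])
qed

lemma real_distribution_weighted_dirac_average:
  assumes "(\<Sum>k=1..n. b k) > 0" "\<And>k. k \<ge> 1 \<Longrightarrow> b k \<ge> 0"
  shows "real_distribution (weighted_dirac_average b x n)"
  using emeasure_weighted_dirac_average_UNIV[OF assms, of x]
  by (auto simp: real_distribution_def real_distribution_axioms_def intro!: prob_spaceI)

text \<open>Values in a real vector space let one notion serve real sequences and complex
  exponentials. If the weights sum to zero, the value is \<open>0\<close>.\<close>

definition weighted_average :: "(nat \<Rightarrow> real) \<Rightarrow> (nat \<Rightarrow> 'a) \<Rightarrow> nat \<Rightarrow> 'a::real_vector" where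
  "weighted_average b f n = (\<Sum>k=1..n. b k *\<^sub>R f k) /\<^sub>R (\<Sum>k=1..n. b k)"

text \<open>The measure is the image under \<open>x\<close> of a discrete density on
  \<open>{1..n}\<close>, so the integral becomes a finite sum for vector-valued \<open>f\<close> at
  once.\<close>

lemma integral_weighted_dirac_average:
  fixes f :: "real \<Rightarrow> 'b::{banach, second_countable_topology}"
  assumes D: "(\<Sum>k=1..n. b k) > 0" and b: "\<And>k. k \<ge> 1 \<Longrightarrow> b k \<ge> 0"
    and [measurable]: "f \<in> borel_measurable borel"
  shows "integral\<^sup>L (weighted_dirac_average b x n) f = weighted_average b (\<lambda>k. f (x k)) n"
proof -
  define D where "D = (\<Sum>k=1..n. b k)"
  let ?N = "density (count_space {1..n}) (\<lambda>k. ennreal (b k / D))"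
  have "weighted_dirac_average b x n = distr ?N borel x"
  proof (rule measure_eqI)
    fix A assume "A \<in> sets (weighted_dirac_average b x n)"
    then have A[measurable]: "A \<in> sets borel" by simp
    have "emeasure (distr ?N borel x) A = (\<integral>\<^sup>+k. ennreal (b k / D) * indicator (x -` A \<inter> {1..n}) k \<partial>count_space {1..n})"
      by (simp add: emeasure_distr emeasure_density)
    also have "\<dots> = (\<Sum>k=1..n. ennreal (b k / D) * indicator (x -` A \<inter> {1..n}) k)"
      by (rule nn_integral_count_space_finite) simp
    also have "\<dots> = (\<Sum>k=1..n. ennreal (1 / D) * (ennreal (b k) * indicator A (x k)))"
      using D b by (intro sum.cong)
        (auto simp: D_def indicator_def ennreal_mult[symmetric])
    also have "\<dots> = emeasure (weighted_dirac_average b x n) A"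
      by (subst emeasure_weighted_dirac_average[OF A]) (simp only: sum_distrib_left D_def)
    finally show "emeasure (weighted_dirac_average b x n) A = emeasure (distr ?N borel x) A" ..
  qed simp
  then have "integral\<^sup>L (weighted_dirac_average b x n) f = (\<integral>k. (b k / D) *\<^sub>R f (x k) \<partial>count_space {1..n})"
    using D b by (simp add: integral_distr integral_density D_def AE_count_space)
  also have "\<dots> = (\<Sum>k=1..n. (b k / D) *\<^sub>R f (x k))"
    by (rule lebesgue_integral_count_space_finite) simp
  finally show ?thesis
    by (simp add: weighted_average_def D_def scaleR_sum_right divide_inverse_commute)
qed

subsection \<open>Averages of complex exponentials\<close>

text \<open>The lower estimate is \<open>1 - y \<le> exp (- y)\<close>. The upper one follows from
  \<open>(1 + y + y\<^sup>2 / 2) * (1 - y + y\<^sup>2 / 2) = 1 + y ^ 4 / 4\<close>, whose first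
  factor is at most \<open>exp y\<close>.\<close>

lemma exp_minus_quadratic_bound:
  fixes y :: real
  assumes "y \<ge> 0"
  shows "\<bar>exp (- y) - (1 - y)\<bar> \<le> y\<^sup>2 / 2"
proof -
  have "1 \<le> (1 + y + y\<^sup>2 / 2) * (1 - y + y\<^sup>2 / 2)"
    using zero_le_power[OF assms, of 4]
    by (simp add: algebra_simps power2_eq_square power4_eq_xxxx)
  also have "\<dots> \<le> exp y * (1 - y + y\<^sup>2 / 2)"
  proof (rule mult_right_mono)
    show "1 + y + y\<^sup>2 / 2 \<le> exp y"
      using assms by (rule exp_lower_Taylor_quadratic)
    have "1 - y + y\<^sup>2 / 2 = ((1 - y)\<^sup>2 + 1) / 2"
      by (simp add: power2_eq_square field_simps)
    also have "\<dots> \<ge> 0"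
      by (intro divide_nonneg_pos add_nonneg_nonneg) auto
    finally show "0 \<le> 1 - y + y\<^sup>2 / 2" .
  qed
  finally have "exp (- y) \<le> 1 - y + y\<^sup>2 / 2"
    by (simp add: exp_minus field_simps)
  with exp_ge_add_one_self[of "- y"] show ?thesis by simp
qed

text \<open>McLeish's factorisation \<open>e\<^bsup>ix\<^esup> = (1 + ix) e\<^bsup>-x\<^sup>2/2 + O(x\<^sup>3)\<^esup>\<close>, with the error made additive so that
  no complex logarithm is needed.\<close>

lemma norm_McLeish_factor_le:
  fixes x :: real
  shows "cmod ((1 + \<i> * x) * of_real (exp (- (x\<^sup>2 / 2)))) \<le> 1"
proof -
  let ?E = "exp (- (x\<^sup>2 / 2)) :: real"
  have "(cmod ((1 + \<i> * x) * ?E))\<^sup>2 = (1 + x\<^sup>2) * exp (- (x\<^sup>2))"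
    by (simp add: norm_mult power_mult_distrib cmod_power2 exp_double[symmetric])
  also have "\<dots> \<le> exp (x\<^sup>2) * exp (- (x\<^sup>2))"
    by (intro mult_right_mono) auto
  also have "\<dots> = 1\<^sup>2"
    by (simp add: exp_minus)
  finally show ?thesis
    by (rule power2_le_imp_le) simp
qed

text \<open>If \<open>\<bar>x\<bar> > 1\<close>, both terms have modulus at most \<open>1\<close>.
  Otherwise both exponentials are replaced by Taylor polynomials;
  \<open>(1 + \<i> * x) * (1 - x\<^sup>2 / 2)\<close> differs from that of \<open>iexp x\<close> by
  a cubic term only.\<close>

lemma iexp_McLeish_bound:
  fixes x :: real
  shows "cmod (iexp x - (1 + \<i> * x) * of_real (exp (- (x\<^sup>2 / 2)))) \<le> 2 * \<bar>x\<bar> ^ 3"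
proof -
  let ?E = "exp (- (x\<^sup>2 / 2)) :: real"
  show "cmod (iexp x - (1 + \<i> * x) * ?E) \<le> 2 * \<bar>x\<bar> ^ 3"
  proof (cases "\<bar>x\<bar> \<le> 1")
    case False
    have "cmod (iexp x - (1 + \<i> * x) * ?E) \<le> 1 + 1"
      by (rule order.trans[OF norm_triangle_ineq4]) (use norm_McLeish_factor_le[of x] in simp)
    also have "\<dots> \<le> 2 * \<bar>x\<bar> ^ 3"
      using False one_le_power[of "\<bar>x\<bar>" 3] by simp
    finally show ?thesis .
  next
    case True
    have 1: "cmod (iexp x - (1 + \<i> * x - x\<^sup>2 / 2)) \<le> \<bar>x\<bar> ^ 3 / 6"
      using iexp_approx1[of x 2]
      by (simp add: numeral_2_eq_2 numeral_3_eq_3 fact_numeral power2_eq_square algebra_simps)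
    have "\<bar>?E - (1 - x\<^sup>2 / 2)\<bar> \<le> (x\<^sup>2)\<^sup>2 / 8"
      using exp_minus_quadratic_bound[of "x\<^sup>2 / 2"] by (simp add: power_divide)
    also have "\<dots> = \<bar>x\<bar> * \<bar>x\<bar> ^ 3 / 8"
      by (simp add: power2_eq_square numeral_3_eq_3 abs_mult_self_eq)
    also have "\<dots> \<le> \<bar>x\<bar> ^ 3 / 8"
      using True by (simp add: mult_left_le_one_le)
    finally have 2: "\<bar>(1 - x\<^sup>2 / 2) - ?E\<bar> \<le> \<bar>x\<bar> ^ 3 / 8"
      by (simp add: abs_minus_commute)
    have "cmod (1 + \<i> * x) \<le> 2"
      by (rule order.trans[OF norm_triangle_ineq]) (use True in \<open>simp add: norm_mult\<close>)
    then have 3: "cmod ((1 + \<i> * x) * of_real ((1 - x\<^sup>2 / 2) - ?E)) \<le> 2 * (\<bar>x\<bar> ^ 3 / 8)"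
      unfolding norm_mult norm_of_real using 2 by (intro mult_mono) auto
    have 4: "cmod (\<i> * of_real (x ^ 3 / 2)) = \<bar>x\<bar> ^ 3 / 2"
      by (simp add: norm_mult norm_power)
    have "iexp x - (1 + \<i> * x) * ?E = (iexp x - (1 + \<i> * x - x\<^sup>2 / 2)) + \<i> * of_real (x ^ 3 / 2)
        + (1 + \<i> * x) * of_real ((1 - x\<^sup>2 / 2) - ?E)"
      by (simp add: algebra_simps power2_eq_square numeral_3_eq_3)
    also have "cmod \<dots> \<le> \<bar>x\<bar> ^ 3 / 6 + \<bar>x\<bar> ^ 3 / 2 + 2 * (\<bar>x\<bar> ^ 3 / 8)"
      using 1 3 4 by (intro norm_triangle_mono) auto
    also have "\<dots> \<le> 2 * \<bar>x\<bar> ^ 3"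
      using zero_le_power[of "\<bar>x\<bar>" 3] by linarith
    finally show ?thesis .
  qed
qed

text \<open>All factors on both sides lie in the closed unit disc, so the products differ by at most
  the sum of the differences of the factors.\<close>

lemma iexp_sum_McLeish_bound:
  fixes x :: "'i \<Rightarrow> real"
  assumes "finite I"
  shows "cmod (iexp (\<Sum>j\<in>I. x j) - (\<Prod>j\<in>I. 1 + \<i> * x j) * of_real (exp (- ((\<Sum>j\<in>I. (x j)\<^sup>2) / 2))))
    \<le> 2 * (\<Sum>j\<in>I. \<bar>x j\<bar> ^ 3)"
proof -
  have lhs: "iexp (\<Sum>j\<in>I. x j) = (\<Prod>j\<in>I. iexp (x j))"
    using assms by (simp add: exp_sum sum_distrib_left)
  have "exp (- ((\<Sum>j\<in>I. (x j)\<^sup>2) / 2)) = (\<Prod>j\<in>I. exp (- ((x j)\<^sup>2 / 2)))"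
    using assms by (simp add: exp_sum[symmetric] sum_negf sum_divide_distrib)
  then have rhs: "(\<Prod>j\<in>I. 1 + \<i> * x j) * of_real (exp (- ((\<Sum>j\<in>I. (x j)\<^sup>2) / 2))) =
      (\<Prod>j\<in>I. (1 + \<i> * x j) * of_real (exp (- ((x j)\<^sup>2 / 2))))"
    by (simp only: prod.distrib of_real_prod)
  have "cmod ((\<Prod>j\<in>I. iexp (x j)) - (\<Prod>j\<in>I. (1 + \<i> * x j) * of_real (exp (- ((x j)\<^sup>2 / 2)))))
      \<le> (\<Sum>j\<in>I. cmod (iexp (x j) - (1 + \<i> * x j) * of_real (exp (- ((x j)\<^sup>2 / 2)))))"
    by (rule norm_prod_diff) (simp, rule norm_McLeish_factor_le)
  also have "\<dots> \<le> (\<Sum>j\<in>I. 2 * \<bar>x j\<bar> ^ 3)"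
    by (intro sum_mono iexp_McLeish_bound)
  finally show ?thesis
    unfolding lhs rhs by (simp only: sum_distrib_left)
qed

text \<open>A Markov estimate: indices with \<open>v k \<ge> \<eta>\<close> carry a share of the
  weight at most \<open>weighted_average b v n / \<eta>\<close>, and there
  \<open>\<delta> k \<le> L\<close>. The indices up to \<open>N\<close> have fixed total weight,
  which is negligible against the diverging sum.\<close>

lemma weighted_average_tendsto_0:
  fixes \<delta> v :: "nat \<Rightarrow> real"
  assumes b: "\<And>k. k \<ge> 1 \<Longrightarrow> b k \<ge> 0"
    and D: "filterlim (\<lambda>n. \<Sum>k=1..n. b k) at_top sequentially"
    and v: "\<And>k. k \<ge> 1 \<Longrightarrow> v k \<ge> 0" "weighted_average b v \<longlonglongrightarrow> 0"
    and \<delta>: "\<And>k. k \<ge> 1 \<Longrightarrow> 0 \<le> \<delta> k" "\<And>k. k \<ge> 1 \<Longrightarrow> \<delta> k \<le> L"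
    and small: "\<And>e. e > 0 \<Longrightarrow> \<exists>\<eta>>0. \<exists>N. \<forall>k\<ge>N. v k < \<eta> \<longrightarrow> \<delta> k \<le> e"
  shows "weighted_average b \<delta> \<longlonglongrightarrow> 0"
proof (rule LIMSEQ_I)
  fix e :: real assume e: "e > 0"
  obtain \<eta> N where \<eta>: "\<eta> > 0" and N: "\<And>k. k \<ge> N \<Longrightarrow> v k < \<eta> \<Longrightarrow> \<delta> k \<le> e / 2"
    using small[of "e / 2"] e by auto
  have L: "L \<ge> 0"
    using \<delta>(1)[of 1] \<delta>(2)[of 1] by simp
  let ?D = "\<lambda>n. \<Sum>k=1..n. b k"
  let ?r = "\<lambda>n. L / \<eta> * weighted_average b v n + L * ?D N * inverse (?D n)"
  have pos: "\<forall>\<^sub>F n in sequentially. ?D n > 0"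
    using D by (simp add: filterlim_at_top_dense)
  have "(\<lambda>n. inverse (?D n)) \<longlonglongrightarrow> 0"
    by (rule tendsto_inverse_0_at_top[OF D])
  then have "?r \<longlonglongrightarrow> L / \<eta> * 0 + L * ?D N * 0"
    by (intro tendsto_intros v)
  then have "\<forall>\<^sub>F n in sequentially. ?r n < e / 2"
    using e by (intro order_tendstoD(2)) auto
  with pos have "\<forall>\<^sub>F n in sequentially. norm (weighted_average b \<delta> n) < e"
  proof eventually_elim
    case (elim n)
    have ptw: "\<delta> k \<le> e / 2 + L / \<eta> * v k + L * (if k \<le> N then 1 else 0)" if "k \<ge> 1" for k
    proof -
      have nn: "0 \<le> L / \<eta> * v k" using L \<eta> v(1)[OF that] by simp
      consider "k \<le> N" | "k > N" "v k < \<eta>" | "v k \<ge> \<eta>" by linarith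
      then show ?thesis
      proof cases
        case 3
        then have "L * 1 \<le> L * (v k / \<eta>)"
          using \<eta> L by (intro mult_left_mono) (auto simp: field_simps)
        then show ?thesis using \<delta>(2)[OF that] e L by auto
      qed (use \<delta>(2)[OF that] N[of k] nn e L in auto)
    qed
    have "(\<Sum>k=1..n. b k * (if k \<le> N then 1 else 0)) \<le> ?D N"
    proof -
      have "(\<Sum>k=1..n. b k * (if k \<le> N then 1 else 0)) = (\<Sum>k\<in>{1..n} \<inter> {..N}. b k)"
        by (subst sum.inter_restrict) (auto intro!: sum.cong)
      also have "\<dots> \<le> ?D N"
        by (intro sum_mono2) (auto intro: b)
      finally show ?thesis .
    qed
    then have tail: "L * (\<Sum>k=1..n. b k * (if k \<le> N then 1 else 0)) \<le> L * ?D N"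
      using L by (rule mult_left_mono)
    have "(\<Sum>k=1..n. b k * \<delta> k) \<le> (\<Sum>k=1..n. b k * (e / 2 + L / \<eta> * v k + L * (if k \<le> N then 1 else 0)))"
      using ptw b by (intro sum_mono mult_left_mono) auto
    also have "\<dots> = e / 2 * ?D n + L / \<eta> * (\<Sum>k=1..n. b k * v k) + L * (\<Sum>k=1..n. b k * (if k \<le> N then 1 else 0))"
      unfolding sum_distrib_left sum.distrib[symmetric] by (intro sum.cong) (auto simp: algebra_simps)
    also have "\<dots> \<le> e / 2 * ?D n + L / \<eta> * (\<Sum>k=1..n. b k * v k) + L * ?D N"
      using tail by simp
    finally have "inverse (?D n) * (\<Sum>k=1..n. b k * \<delta> k) \<le>
        inverse (?D n) * (e / 2 * ?D n + L / \<eta> * (\<Sum>k=1..n. b k * v k) + L * ?D N)"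
      using elim by (intro mult_left_mono) auto
    then have "weighted_average b \<delta> n \<le> e / 2 + ?r n"
      using elim by (simp add: weighted_average_def field_simps)
    moreover have "weighted_average b \<delta> n \<ge> 0"
      unfolding weighted_average_def using elim b \<delta>
      by (auto intro!: mult_nonneg_nonneg sum_nonneg)
    ultimately show ?case
      using elim unfolding real_norm_def by linarith
  qed
  then show "\<exists>no. \<forall>n\<ge>no. norm (weighted_average b \<delta> n - 0) < e"
    by (simp add: eventually_sequentially)
qed

lemma weighted_average_norm_tendsto_0:
  fixes f :: "nat \<Rightarrow> 'a::real_normed_vector"
  assumes b: "\<And>k. k \<ge> 1 \<Longrightarrow> b k \<ge> 0" and "weighted_average b (\<lambda>k. norm (f k)) \<longlonglongrightarrow> 0"
  shows "weighted_average b f \<longlonglongrightarrow> 0"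
proof (rule tendsto_norm_zero_cancel, rule tendsto_sandwich[OF _ _ tendsto_const assms(2)])
  have "norm (weighted_average b f n) \<le> weighted_average b (\<lambda>k. norm (f k)) n" for n
  proof -
    have "norm (\<Sum>k=1..n. b k *\<^sub>R f k) \<le> (\<Sum>k=1..n. b k * norm (f k))"
      by (rule order.trans[OF norm_sum]) (use b in auto)
    moreover have "(\<Sum>k=1..n. b k) \<ge> 0"
      using b by (auto intro: sum_nonneg)
    ultimately show ?thesis
      by (simp add: weighted_average_def mult_left_mono)
  qed
  then show "\<forall>\<^sub>F n in sequentially. norm (weighted_average b f n) \<le> weighted_average b (\<lambda>k. norm (f k)) n"
    by simp
qed simp

subsection \<open>A strong law for weighted averages\<close>

text \<open>Along \<open>n\<^sub>i\<close> with \<open>b\<^sub>1 + \<dots> + b\<^bsub>n\<^sub>i\<^esub> \<approx> i\<^sup>2\<close> the second moments of the averages are summable; pathwise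
  boundedness fills the gaps, since \<open>(i + 1)\<^sup>2 / i\<^sup>2 \<rightarrow> 1\<close>.\<close>

lemma (in prob_space) strong_law_weighted_average:
  fixes Y :: "nat \<Rightarrow> 'a \<Rightarrow> complex"
  assumes b: "\<And>k. k \<ge> 1 \<Longrightarrow> b k \<ge> 0"
    and D: "filterlim (\<lambda>n. \<Sum>k=1..n. b k) at_top sequentially"
    and [measurable]: "\<And>k. k \<ge> 1 \<Longrightarrow> Y k \<in> borel_measurable M"
    and int: "\<And>n. integrable M (\<lambda>\<omega>. (cmod (\<Sum>k=1..n. b k *\<^sub>R Y k \<omega>))\<^sup>2)"
    and moment: "\<And>n. expectation (\<lambda>\<omega>. (cmod (\<Sum>k=1..n. b k *\<^sub>R Y k \<omega>))\<^sup>2) \<le> K * (\<Sum>k=1..n. b k)"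
    and bounded: "AE \<omega> in M. \<exists>L. \<forall>k\<ge>1. cmod (Y k \<omega>) \<le> L"
  shows "AE \<omega> in M. weighted_average b (\<lambda>k. Y k \<omega>) \<longlonglongrightarrow> 0"
proof -
  define D where "D n = (\<Sum>k=1..n. b k)" for n
  define R where "R n \<omega> = (\<Sum>k=1..n. b k *\<^sub>R Y k \<omega>)" for n \<omega>
  \<comment> \<open>Taking \<open>Suc i\<close> instead of \<open>i\<close> keeps every
    \<open>D (m i)\<close> positive.\<close>
  define m where "m i = (LEAST n. D n \<ge> (real (Suc i))\<^sup>2)" for i
  have mono: "D n \<le> D n'" if "n \<le> n'" for n n'
    unfolding D_def using that b by (intro sum_mono2) auto
  have D_top: "filterlim D at_top sequentially"
    using D by (simp add: D_def[abs_def])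
  have m_ge: "D (m i) \<ge> (real (Suc i))\<^sup>2" for i
  proof -
    have "\<exists>n. D n \<ge> (real (Suc i))\<^sup>2"
      using D_top unfolding filterlim_at_top by (metis eventually_happens' sequentially_bot)
    then show ?thesis unfolding m_def by (rule LeastI_ex)
  qed
  have m_pos: "D (m i) > 0" for i
    by (rule less_le_trans[OF _ m_ge]) simp
  have K: "K \<ge> 0"
  proof -
    have "0 \<le> expectation (\<lambda>\<omega>. (cmod (R (m 0) \<omega>))\<^sup>2)" by simp
    also have "\<dots> \<le> K * D (m 0)" unfolding R_def D_def by (rule moment)
    finally show ?thesis using m_pos[of 0] by (simp add: zero_le_mult_iff)
  qed
  have [measurable]: "R n \<in> borel_measurable M" for n
    unfolding R_def[abs_def] by measurable
  define q where "q i \<omega> = (cmod (R (m i) \<omega>) / D (m i))\<^sup>2" for i \<omega>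
  have [measurable]: "q i \<in> borel_measurable M" for i
    unfolding q_def[abs_def] by measurable
  have q_int: "integrable M (q i)" for i
    using int[of "m i"] by (simp add: q_def[abs_def] R_def power_divide)
  have q_moment: "expectation (q i) \<le> K / (real (Suc i))\<^sup>2" for i
  proof -
    have "expectation (q i) = expectation (\<lambda>\<omega>. (cmod (R (m i) \<omega>))\<^sup>2) / (D (m i))\<^sup>2"
      by (simp add: q_def[abs_def] power_divide)
    also have "\<dots> \<le> K * D (m i) / (D (m i))\<^sup>2"
      unfolding R_def D_def by (intro divide_right_mono moment) auto
    also have "\<dots> = K / D (m i)"
      using m_pos[of i] by (simp add: power2_eq_square)
    also have "\<dots> \<le> K / (real (Suc i))\<^sup>2"
      using K m_ge[of i] m_pos[of i] by (intro divide_left_mono) auto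
    finally show ?thesis .
  qed
  have summ: "summable (\<lambda>i. K / (real (Suc i))\<^sup>2)"
    using summable_mult[OF inverse_power_summable[of 2], of K]
    by (subst summable_Suc_iff) (simp add: divide_inverse)
  \<comment> \<open>The sum of the \<open>q i\<close> has finite expectation, hence is almost surely
    finite, and so its terms tend to zero.\<close>
  have "AE \<omega> in M. (\<Sum>i. ennreal (q i \<omega>)) \<noteq> \<infinity>"
  proof (rule nn_integral_PInf_AE)
    have "(\<integral>\<^sup>+\<omega>. (\<Sum>i. ennreal (q i \<omega>)) \<partial>M) = (\<Sum>i. \<integral>\<^sup>+\<omega>. ennreal (q i \<omega>) \<partial>M)"
      by (rule nn_integral_suminf) measurable
    also have "\<dots> \<le> (\<Sum>i. ennreal (K / (real (Suc i))\<^sup>2))"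
    proof (intro suminf_le)
      show "(\<integral>\<^sup>+\<omega>. ennreal (q i \<omega>) \<partial>M) \<le> ennreal (K / (real (Suc i))\<^sup>2)" for i
      proof -
        have "(\<integral>\<^sup>+\<omega>. ennreal (q i \<omega>) \<partial>M) = ennreal (expectation (q i))"
          by (rule nn_integral_eq_integral[OF q_int]) (simp add: q_def)
        then show ?thesis by (simp only: ennreal_leI[OF q_moment])
      qed
    qed auto
    also have "\<dots> < \<infinity>"
      using summ K by (simp add: suminf_ennreal2 del: of_nat_Suc)
    finally show "(\<integral>\<^sup>+\<omega>. (\<Sum>i. ennreal (q i \<omega>)) \<partial>M) \<noteq> \<infinity>" by simp
  qed measurable
  with bounded show ?thesis
  proof eventually_elim
    case (elim \<omega>)
    from elim(1) obtain L where L: "\<And>k. k \<ge> 1 \<Longrightarrow> cmod (Y k \<omega>) \<le> L" by blast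
    have L0: "L \<ge> 0" using order.trans[OF norm_ge_zero L[of 1]] by simp
    have "summable (\<lambda>i. q i \<omega>)"
      using elim(2) by (intro summable_suminf_not_top) (auto simp: q_def)
    then have "(\<lambda>i. q i \<omega>) \<longlonglongrightarrow> 0"
      by (rule summable_LIMSEQ_zero)
    then have "(\<lambda>i. sqrt (q i \<omega>)) \<longlonglongrightarrow> sqrt 0"
      by (rule tendsto_real_sqrt)
    then have sub: "(\<lambda>i. cmod (R (m i) \<omega>) / D (m i)) \<longlonglongrightarrow> 0"
      using m_pos by (simp add: q_def less_imp_le)
    have gap: "(\<lambda>i. ((real i + 2)\<^sup>2 - (real i + 1)\<^sup>2) / (real i + 1)\<^sup>2) \<longlonglongrightarrow> 0"
      by real_asymp
    \<comment> \<open>Once \<open>D n \<ge> 1\<close>, this is the largest \<open>i\<close> with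
      \<open>(i + 1)\<^sup>2 \<le> D n\<close>; the \<open>- 1\<close> matches the
      \<open>Suc i\<close> in \<open>m\<close>. Thus \<open>m (\<iota> n) \<le> n\<close> and
      \<open>D n \<le> (\<iota> n + 2)\<^sup>2\<close>.\<close>
    define \<iota> where "\<iota> n = nat \<lfloor>sqrt (D n)\<rfloor> - 1" for n
    have \<iota>_top: "filterlim \<iota> at_top sequentially"
    proof -
      have "filterlim (\<lambda>x::real. nat \<lfloor>sqrt x\<rfloor> - 1) at_top at_top"
        by real_asymp
      from filterlim_compose[OF this D_top] show ?thesis
        by (simp add: \<iota>_def[abs_def])
    qed
    have lim: "(\<lambda>n. cmod (R (m (\<iota> n)) \<omega>) / D (m (\<iota> n)) +
        L * (((real (\<iota> n) + 2)\<^sup>2 - (real (\<iota> n) + 1)\<^sup>2) / (real (\<iota> n) + 1)\<^sup>2)) \<longlonglongrightarrow> 0 + L * 0"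
      by (intro tendsto_add tendsto_mult tendsto_const filterlim_compose[OF sub \<iota>_top]
          filterlim_compose[OF gap \<iota>_top])
    have "\<forall>\<^sub>F n in sequentially. D n \<ge> 1"
      using D_top by (simp add: filterlim_at_top)
    then have "\<forall>\<^sub>F n in sequentially. norm (weighted_average b (\<lambda>k. Y k \<omega>) n) \<le>
        cmod (R (m (\<iota> n)) \<omega>) / D (m (\<iota> n)) +
        L * (((real (\<iota> n) + 2)\<^sup>2 - (real (\<iota> n) + 1)\<^sup>2) / (real (\<iota> n) + 1)\<^sup>2)"
    proof eventually_elim
      case (elim n)
      define i where "i = \<iota> n"
      have s1: "sqrt (D n) \<ge> 1" using elim by simp
      then have i_floor: "real i + 1 = of_int \<lfloor>sqrt (D n)\<rfloor>"
        by (simp add: i_def \<iota>_def of_nat_diff le_nat_floor)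
      have "(real i + 1)\<^sup>2 \<le> (sqrt (D n))\<^sup>2"
        unfolding i_floor using s1 by (intro power_mono) auto
      then have lo: "(real (Suc i))\<^sup>2 \<le> D n"
        using elim by (simp add: add.commute)
      then have mn: "m i \<le> n"
        unfolding m_def by (rule Least_le)
      have "(sqrt (D n))\<^sup>2 \<le> (real i + 2)\<^sup>2"
      proof (rule power_mono)
        show "sqrt (D n) \<le> real i + 2" using i_floor by linarith
      qed (use s1 in simp)
      then have hi: "D n \<le> (real i + 2)\<^sup>2"
        using elim by simp
      from mn obtain p where p: "n = m i + p" using le_Suc_ex by blast
      have R_split: "R n \<omega> = R (m i) \<omega> + (\<Sum>k=m i + 1..n. b k *\<^sub>R Y k \<omega>)"
        unfolding R_def p by (rule sum.ub_add_nat) simp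
      have D_split: "D n = D (m i) + (\<Sum>k=m i + 1..n. b k)"
        unfolding D_def p by (rule sum.ub_add_nat) simp
      \<comment> \<open>The terms after \<open>m i\<close> contribute at most \<open>L\<close> times
        their total weight, which the gap between consecutive squares bounds.\<close>
      have "cmod (\<Sum>k=m i + 1..n. b k *\<^sub>R Y k \<omega>) \<le> (\<Sum>k=m i + 1..n. b k * L)"
        by (rule order.trans[OF norm_sum]) (auto intro!: sum_mono mult_left_mono b L simp: b)
      also have "\<dots> = L * (D n - D (m i))"
        using D_split by (simp add: sum_distrib_left mult.commute)
      also have "\<dots> \<le> L * ((real i + 2)\<^sup>2 - (real i + 1)\<^sup>2)"
        using hi m_ge[of i] L0 by (intro mult_left_mono) (auto simp: add.commute)
      finally have rest: "cmod (\<Sum>k=m i + 1..n. b k *\<^sub>R Y k \<omega>) \<le> L * ((real i + 2)\<^sup>2 - (real i + 1)\<^sup>2)" .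
      have gap0: "(real i + 2)\<^sup>2 - (real i + 1)\<^sup>2 \<ge> 0"
        by (simp add: power2_eq_square algebra_simps)
      have "norm (weighted_average b (\<lambda>k. Y k \<omega>) n) = cmod (R n \<omega>) / D n"
        using elim by (simp add: weighted_average_def R_def D_def divide_inverse mult.commute)
      also have "\<dots> \<le> cmod (R (m i) \<omega>) / D n + L * ((real i + 2)\<^sup>2 - (real i + 1)\<^sup>2) / D n"
        unfolding R_split add_divide_distrib[symmetric] using elim rest
        by (intro divide_right_mono order.trans[OF norm_triangle_ineq]) auto
      also have "\<dots> \<le> cmod (R (m i) \<omega>) / D (m i) +
          L * ((real i + 2)\<^sup>2 - (real i + 1)\<^sup>2) / (real i + 1)\<^sup>2"
        using elim mono[OF mn] m_pos[of i] lo L0 gap0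
        by (intro add_mono divide_left_mono mult_nonneg_nonneg mult_pos_pos) (auto simp: add.commute)
      finally show ?case by (simp add: i_def)
    qed
    then show ?case
      by (rule Lim_null_comparison) (use lim in simp)
  qed
qed

subsection \<open>Stopped products of reverse martingale differences\<close>

text \<open>\<open>c\<close> is the stopping threshold and \<open>s\<close> the scale. Only entries
  after \<open>j\<close> occur, so for the decreasing filtration this is a predictable coefficient
  for \<open>z j\<close>.\<close>

definition stop_coeff :: "(nat \<Rightarrow> real) \<Rightarrow> real \<Rightarrow> real \<Rightarrow> nat \<Rightarrow> nat \<Rightarrow> complex" where
  "stop_coeff z c s k j =
     (if (\<Sum>i\<in>{j<..k}. (z i)\<^sup>2) \<le> c then \<Prod>i\<in>{j<..k}. 1 + \<i> * of_real (s * z i) else 0)"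

text \<open>The stopped product minus \<open>1\<close>, written as a martingale transform so that
  orthogonality applies term by term; \<open>stopped_sum_eq_prod\<close> recovers the
  product.\<close>

definition stopped_sum :: "(nat \<Rightarrow> real) \<Rightarrow> real \<Rightarrow> real \<Rightarrow> nat \<Rightarrow> complex" where
  "stopped_sum z c s k = (\<Sum>j=1..k. \<i> * of_real (s * z j) * stop_coeff z c s k j)"

text \<open>Each factor satisfies \<open>cmod (1 + \<i> * x) = sqrt (1 + x\<^sup>2) \<le> exp
  (x\<^sup>2 / 2)\<close>.\<close>

lemma norm_prod_McLeish_le:
  fixes z :: "nat \<Rightarrow> real"
  assumes "(\<Sum>i\<in>I. (z i)\<^sup>2) \<le> c"
  shows "cmod (\<Prod>i\<in>I. 1 + \<i> * of_real (s * z i)) \<le> exp (s\<^sup>2 * c / 2)"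
proof -
  have "cmod (1 + \<i> * of_real x) \<le> exp (x\<^sup>2 / 2)" for x :: real
  proof (rule power2_le_imp_le)
    have "(cmod (1 + \<i> * of_real x))\<^sup>2 = 1 + x\<^sup>2"
      by (simp add: cmod_power2)
    also have "\<dots> \<le> exp (x\<^sup>2)"
      by simp
    also have "\<dots> = (exp (x\<^sup>2 / 2))\<^sup>2"
      by (simp add: exp_double[symmetric])
    finally show "(cmod (1 + \<i> * of_real x))\<^sup>2 \<le> (exp (x\<^sup>2 / 2))\<^sup>2" .
  qed simp
  then have "cmod (\<Prod>i\<in>I. 1 + \<i> * of_real (s * z i)) \<le> (\<Prod>i\<in>I. exp ((s * z i)\<^sup>2 / 2))"
    unfolding prod_norm[symmetric] by (intro prod_mono) (auto simp del: of_real_mult)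
  also have "\<dots> \<le> exp (s\<^sup>2 * (\<Sum>i\<in>I. (z i)\<^sup>2) / 2)"
    by (cases "finite I")
      (simp_all add: exp_sum[symmetric] power_mult_distrib sum_distrib_left sum_divide_distrib)
  also have "\<dots> \<le> exp (s\<^sup>2 * c / 2)"
    using assms by (simp add: mult_left_mono)
  finally show ?thesis .
qed

lemma norm_stop_coeff_le: "cmod (stop_coeff z c s k j) \<le> exp (s\<^sup>2 * c / 2)"
  using norm_prod_McLeish_le[of z "{j<..k}" c s] by (simp add: stop_coeff_def)

text \<open>The summand at \<open>j\<close> is the product over \<open>{j..k}\<close> minus the
  product over \<open>{j<..k}\<close>.\<close>

lemma telescope_prod_downward:
  fixes x :: "nat \<Rightarrow> complex"
  assumes "m \<le> Suc k"
  shows "(\<Sum>j\<in>{m..k}. x j * (\<Prod>i\<in>{j<..k}. 1 + x i)) = (\<Prod>i\<in>{m..k}. 1 + x i) - 1"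
  using assms
proof (induction m rule: inc_induct)
  case (step m)
  have "{m..k} = insert m {Suc m..k}" "{m<..k} = {Suc m..k}"
    using step by auto
  with step.IH show ?case by (simp add: algebra_simps)
qed simp

lemma stopping_index:
  fixes z :: "nat \<Rightarrow> real"
  assumes "c \<ge> 0" "k \<ge> 1"
  obtains m where "m \<in> {1..k}" "(\<Sum>i\<in>{m<..k}. (z i)\<^sup>2) \<le> c"
    "\<And>j. j \<ge> 1 \<Longrightarrow> (\<Sum>i\<in>{j<..k}. (z i)\<^sup>2) \<le> c \<longleftrightarrow> m \<le> j"
    "(\<Sum>j=1..k. (z j)\<^sup>2) \<le> c \<Longrightarrow> m = 1"
proof -
  let ?P = "\<lambda>j. j \<ge> 1 \<and> (\<Sum>i\<in>{j<..k}. (z i)\<^sup>2) \<le> c"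
  define m where "m = (LEAST j. ?P j)"
  have k: "?P k" using assms by simp
  then have m: "?P m" unfolding m_def by (rule LeastI)
  have "m \<le> k" unfolding m_def using k by (rule Least_le)
  moreover have "?P j \<longleftrightarrow> m \<le> j" if "j \<ge> 1" for j
  proof
    show "?P j \<Longrightarrow> m \<le> j" unfolding m_def by (rule Least_le)
    assume "m \<le> j"
    then have "(\<Sum>i\<in>{j<..k}. (z i)\<^sup>2) \<le> (\<Sum>i\<in>{m<..k}. (z i)\<^sup>2)"
      by (intro sum_mono2) auto
    with m that show "?P j" by simp
  qed
  moreover have "m = 1" if "(\<Sum>j=1..k. (z j)\<^sup>2) \<le> c"
  proof -
    have "(\<Sum>i\<in>{1<..k}. (z i)\<^sup>2) \<le> (\<Sum>j=1..k. (z j)\<^sup>2)"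
      by (intro sum_mono2) auto
    with that have "m \<le> 1"
      unfolding m_def by (intro Least_le) auto
    with m show ?thesis by simp
  qed
  ultimately show thesis using m that[of m] by auto
qed

lemma stopped_sum_eq_prod:
  assumes m: "m \<in> {1..k}" "\<And>j. j \<ge> 1 \<Longrightarrow> (\<Sum>i\<in>{j<..k}. (z i)\<^sup>2) \<le> c \<longleftrightarrow> m \<le> j"
  shows "stopped_sum z c s k = (\<Prod>i\<in>{m..k}. 1 + \<i> * of_real (s * z i)) - 1"
proof -
  have "stopped_sum z c s k =
      (\<Sum>j\<in>{m..k}. \<i> * of_real (s * z j) * (\<Prod>i\<in>{j<..k}. 1 + \<i> * of_real (s * z i)))"
    unfolding stopped_sum_def using m
    by (intro sum.mono_neutral_cong_right) (auto simp: stop_coeff_def)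
  also have "\<dots> = (\<Prod>i\<in>{m..k}. 1 + \<i> * of_real (s * z i)) - 1"
    using m by (intro telescope_prod_downward) auto
  finally show ?thesis .
qed

lemma stopped_sum_unstopped:
  assumes "k \<ge> 1" "(\<Sum>j=1..k. (z j)\<^sup>2) \<le> c"
  shows "stopped_sum z c s k = (\<Prod>i=1..k. 1 + \<i> * of_real (s * z i)) - 1"
proof -
  have "c \<ge> 0" using assms(2) by (rule order.trans[rotated]) (simp add: sum_nonneg)
  from stopping_index[OF this assms(1), of z] assms(2) stopped_sum_eq_prod[of _ k z c s]
  show ?thesis by metis
qed

text \<open>The squares after the stopping index total at most \<open>c\<close>; the overshooting
  factor adds at most \<open>d\<close>.\<close>

lemma norm_stopped_sum_le:
  assumes "c \<ge> 0" "k \<ge> 1" "\<And>j. j \<in> {1..k} \<Longrightarrow> (z j)\<^sup>2 \<le> d"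
  shows "cmod (1 + stopped_sum z c s k) \<le> exp (s\<^sup>2 * (c + d) / 2)"
proof -
  obtain m where m: "m \<in> {1..k}" "(\<Sum>i\<in>{m<..k}. (z i)\<^sup>2) \<le> c"
    "\<And>j. j \<ge> 1 \<Longrightarrow> (\<Sum>i\<in>{j<..k}. (z i)\<^sup>2) \<le> c \<longleftrightarrow> m \<le> j"
    using stopping_index[OF assms(1,2), of z] by metis
  have "{m..k} = insert m {m<..k}" using m(1) by auto
  then have "(\<Sum>i\<in>{m..k}. (z i)\<^sup>2) \<le> c + d"
    using assms(3)[OF m(1)] m(2) by simp
  from norm_prod_McLeish_le[OF this] show ?thesis
    by (simp add: stopped_sum_eq_prod[OF m(1,3)])
qed

text \<open>Again only one square can overshoot \<open>c\<close>. Bounding it by the maximum is what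
  lets the maximal moment assumption enter.\<close>

lemma sum_unstopped_squares_le:
  fixes z :: "nat \<Rightarrow> real"
  assumes "c \<ge> 0" "k \<ge> 1"
  shows "(\<Sum>j=1..k. if (\<Sum>i\<in>{j<..k}. (z i)\<^sup>2) \<le> c then (z j)\<^sup>2 else 0) \<le> c + (MAX j\<in>{1..k}. \<bar>z j\<bar>\<^sup>2)"
proof -
  obtain m where m: "m \<in> {1..k}" "(\<Sum>i\<in>{m<..k}. (z i)\<^sup>2) \<le> c"
    "\<And>j. j \<ge> 1 \<Longrightarrow> (\<Sum>i\<in>{j<..k}. (z i)\<^sup>2) \<le> c \<longleftrightarrow> m \<le> j"
    using stopping_index[OF assms, of z] by metis
  have "(\<Sum>j=1..k. if (\<Sum>i\<in>{j<..k}. (z i)\<^sup>2) \<le> c then (z j)\<^sup>2 else 0) = (\<Sum>j\<in>{m..k}. (z j)\<^sup>2)"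
    using m by (intro sum.mono_neutral_cong_right) auto
  also have "{m..k} = insert m {m<..k}" using m(1) by auto
  also have "(\<Sum>j\<in>insert m {m<..k}. (z j)\<^sup>2) \<le> (MAX j\<in>{1..k}. \<bar>z j\<bar>\<^sup>2) + c"
    using m(1,2) by (subst sum.insert) (auto intro!: add_mono Max_ge)
  finally show ?thesis by simp
qed

lemma borel_measurable_cnj [measurable (raw)]:
  "f \<in> borel_measurable M \<Longrightarrow> (\<lambda>x. cnj (f x)) \<in> borel_measurable M"
  by (rule measurable_compose[OF _ borel_measurable_continuous_onI]) (auto intro: continuous_intros)

section \<open>Orthogonality in reverse time\<close>

locale reverse_martingale_differences = prob_space M for M :: "'a measure" +
  fixes F :: "nat \<Rightarrow> 'a measure" and Z :: "nat \<Rightarrow> 'a \<Rightarrow> real"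
  assumes subalg: "\<And>n. n \<ge> 1 \<Longrightarrow> subalgebra M (F n)"
    and subalg_Suc: "\<And>n. n \<ge> 1 \<Longrightarrow> subalgebra (F n) (F (Suc n))"
    and Z_adapted: "\<And>n. n \<ge> 1 \<Longrightarrow> Z n \<in> borel_measurable (F n)"
    and Z_square_integrable: "\<And>n. n \<ge> 1 \<Longrightarrow> integrable M (\<lambda>\<omega>. (Z n \<omega>)\<^sup>2)"
    and cond_exp_Z: "\<And>n. n \<ge> 1 \<Longrightarrow> AE \<omega> in M. real_cond_exp M (F (Suc n)) (Z n) \<omega> = 0"
begin

lemma subalg_mono:
  assumes "1 \<le> i" "i \<le> j"
  shows "subalgebra (F i) (F j)"
  using assms(2)
proof (induction j rule: dec_induct)
  case base
  then show ?case by (simp add: subalgebra_def)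
next
  case (step n)
  then show ?case using subalg_Suc[of n] assms(1) unfolding subalgebra_def by auto
qed

lemma adapted_mono: "1 \<le> i \<Longrightarrow> i \<le> j \<Longrightarrow> Z j \<in> borel_measurable (F i)"
  using measurable_from_subalg[OF subalg_mono Z_adapted] by auto

lemma measurable_Z: "1 \<le> i \<Longrightarrow> Z i \<in> borel_measurable M"
  using measurable_from_subalg[OF subalg Z_adapted] by auto

lemma stop_coeff_measurable:
  "(\<lambda>\<omega>. stop_coeff (\<lambda>i. Z i \<omega>) c s k j) \<in> borel_measurable (F (Suc j))"
proof -
  have [measurable]: "i \<in> {j<..k} \<Longrightarrow> Z i \<in> borel_measurable (F (Suc j))" for i
    by (rule adapted_mono) auto
  show ?thesis
    unfolding stop_coeff_def by measurable
qed

lemma stopped_sum_measurable: "(\<lambda>\<omega>. stopped_sum (\<lambda>i. Z i \<omega>) c s k) \<in> borel_measurable M"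
proof -
  have [measurable]: "(\<lambda>\<omega>. stop_coeff (\<lambda>i. Z i \<omega>) c s k j) \<in> borel_measurable M" for j
    by (rule measurable_from_subalg[OF subalg stop_coeff_measurable]) simp
  have [measurable]: "i \<in> {1..k} \<Longrightarrow> Z i \<in> borel_measurable M" for i
    by (rule measurable_Z) auto
  show ?thesis unfolding stopped_sum_def by measurable
qed

lemma integrable_Z_mult: "1 \<le> i \<Longrightarrow> 1 \<le> j \<Longrightarrow> integrable M (\<lambda>\<omega>. Z i \<omega> * Z j \<omega>)"
proof -
  assume ij: "1 \<le> i" "1 \<le> j"
  note [measurable] = measurable_Z[OF ij(1)] measurable_Z[OF ij(2)]
  have "\<bar>x * y\<bar> \<le> x\<^sup>2 + y\<^sup>2" for x y :: real
  proof -
    have "2 * \<bar>x * y\<bar> \<le> x\<^sup>2 + y\<^sup>2"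
      using sum_squares_bound[of "\<bar>x\<bar>" "\<bar>y\<bar>"] by (simp add: abs_mult mult.assoc)
    then show ?thesis by simp
  qed
  then show ?thesis
    by (intro Bochner_Integration.integrable_bound[OF Bochner_Integration.integrable_add[OF
        Z_square_integrable[OF ij(1)] Z_square_integrable[OF ij(2)]]]) auto
qed

text \<open>\<open>W\<close> can be pulled out of the conditional expectation given
  \<open>F (Suc i)\<close>, which annihilates \<open>Z i\<close>.\<close>

lemma expectation_mult_Z_real:
  assumes "1 \<le> i" "W \<in> borel_measurable (F (Suc i))" "integrable M (\<lambda>\<omega>. W \<omega> * Z i \<omega>)"
  shows "expectation (\<lambda>\<omega>. W \<omega> * Z i \<omega>) = 0"
proof -
  interpret S: finite_measure_subalgebra M "F (Suc i)"
    by standard (simp add: subalg)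
  have "expectation (\<lambda>\<omega>. W \<omega> * Z i \<omega>) = expectation (\<lambda>\<omega>. W \<omega> * real_cond_exp M (F (Suc i)) (Z i) \<omega>)"
    using S.real_cond_exp_intg(2)[OF assms(3,2) measurable_Z[OF assms(1)]] by simp
  also have "\<dots> = expectation (\<lambda>\<omega>. 0)"
    using cond_exp_Z[OF assms(1)] measurable_from_subalg[OF subalg assms(2)]
    by (intro integral_cong_AE) (auto elim!: eventually_mono)
  finally show ?thesis by simp
qed


lemma integrable_cross_term:
  assumes ij: "1 \<le> i" "1 \<le> j"
  shows "integrable M (\<lambda>\<omega>. Re (stop_coeff (\<lambda>i. Z i \<omega>) c s k i * cnj (stop_coeff (\<lambda>i. Z i \<omega>) c' s' l j)) * Z j \<omega> * Z i \<omega>)"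
proof -
  note [measurable] = measurable_Z[OF ij(1)] measurable_Z[OF ij(2)]
  let ?K = "exp (s\<^sup>2 * c / 2) * exp (s'\<^sup>2 * c' / 2)"
  have [measurable]: "(\<lambda>\<omega>. stop_coeff (\<lambda>i. Z i \<omega>) c s k j) \<in> borel_measurable M" for c s k j
    by (rule measurable_from_subalg[OF subalg stop_coeff_measurable]) simp
  have "\<bar>Re (stop_coeff z c s k i * cnj (stop_coeff z c' s' l j))\<bar> \<le> ?K" for z
    by (rule order.trans[OF abs_Re_le_cmod])
      (simp add: norm_mult norm_stop_coeff_le mult_mono)
  then show ?thesis
    by (intro Bochner_Integration.integrable_bound[OF Bochner_Integration.integrable_mult_right[OF
        integrable_Z_mult[OF ij], of ?K]])
      (auto simp: abs_mult mult_ac intro!: AE_I2 mult_left_mono)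
qed

text \<open>The smaller index is the later one in reverse time. If \<open>i < j\<close>, everything
  except \<open>Z i\<close> is measurable for \<open>F (Suc i)\<close>; the case
  \<open>j < i\<close> follows because conjugation preserves the real part.\<close>

lemma expectation_cross_term:
  assumes ij: "1 \<le> i" "1 \<le> j" "i \<noteq> j"
  shows "expectation (\<lambda>\<omega>. Re (stop_coeff (\<lambda>i. Z i \<omega>) c s k i * cnj (stop_coeff (\<lambda>i. Z i \<omega>) c' s' l j)) * Z j \<omega> * Z i \<omega>) = 0"
proof -
  have *: "expectation (\<lambda>\<omega>. Re (stop_coeff (\<lambda>i. Z i \<omega>) c s k i * cnj (stop_coeff (\<lambda>i. Z i \<omega>) c' s' l j)) * Z j \<omega> * Z i \<omega>) = 0"
    if "1 \<le> i" "i < j" for c s k i c' s' l j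
  proof (rule expectation_mult_Z_real[OF that(1)])
    have [measurable]: "Z j \<in> borel_measurable (F (Suc i))"
      using that by (intro adapted_mono) auto
    have [measurable]: "(\<lambda>\<omega>. stop_coeff (\<lambda>i. Z i \<omega>) c' s' l j) \<in> borel_measurable (F (Suc i))"
      using that by (intro measurable_from_subalg[OF subalg_mono stop_coeff_measurable]) auto
    note stop_coeff_measurable[measurable]
    show "(\<lambda>\<omega>. Re (stop_coeff (\<lambda>i. Z i \<omega>) c s k i * cnj (stop_coeff (\<lambda>i. Z i \<omega>) c' s' l j)) * Z j \<omega>)
        \<in> borel_measurable (F (Suc i))"
      by measurable
  qed (use that in \<open>intro integrable_cross_term; linarith\<close>)
  show ?thesis
  proof (cases "i < j")
    case False
    then have "j < i" using ij by simp
    from *[OF ij(2) this, of c' s' l c s k] show ?thesis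
      by (simp add: mult_ac)
  qed (rule *[OF ij(1)])
qed

text \<open>The factors \<open>\<i>\<close> and \<open>cnj \<i>\<close> multiply to
  \<open>1\<close>, leaving real scalars times the cross terms.\<close>

lemma Re_stopped_sum_mult:
  "Re (stopped_sum z c s k * cnj (stopped_sum z c' s' l)) =
    (\<Sum>i=1..k. \<Sum>j=1..l. s * s' * (Re (stop_coeff z c s k i * cnj (stop_coeff z c' s' l j)) * z j * z i))"
  unfolding stopped_sum_def cnj_sum sum_product Re_sum
  by (intro sum.cong refl) (simp add: algebra_simps)

lemma integrable_stopped_sum_mult:
  "integrable M (\<lambda>\<omega>. Re (stopped_sum (\<lambda>i. Z i \<omega>) c s k * cnj (stopped_sum (\<lambda>i. Z i \<omega>) c' s' l)))"
  unfolding Re_stopped_sum_mult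
  by (intro Bochner_Integration.integrable_sum Bochner_Integration.integrable_mult_right
      integrable_cross_term) auto

lemma integrable_Max_square:
  "l \<ge> 1 \<Longrightarrow> integrable M (\<lambda>\<omega>. MAX j\<in>{1..l}. \<bar>Z j \<omega>\<bar>\<^sup>2)"
  by (intro integrable_MAX) (auto intro: Z_square_integrable)

text \<open>Orthogonality leaves only the diagonal terms \<open>Z\<^sub>j\<^sup>2\<close> with \<open>j \<le> min k l\<close>, and the stopping rule of
  either sum caps them.\<close>

lemma covariance_stopped_sum_le:
  assumes "l \<ge> 1" "c' \<ge> 0"
  shows "expectation (\<lambda>\<omega>. Re (stopped_sum (\<lambda>i. Z i \<omega>) c s k * cnj (stopped_sum (\<lambda>i. Z i \<omega>) c' s' l)))
    \<le> \<bar>s * s'\<bar> * (exp (s\<^sup>2 * c / 2) * exp (s'\<^sup>2 * c' / 2)) * (c' + expectation (\<lambda>\<omega>. MAX j\<in>{1..l}. \<bar>Z j \<omega>\<bar>\<^sup>2))"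
proof -
  let ?K = "exp (s\<^sup>2 * c / 2) * exp (s'\<^sup>2 * c' / 2)"
  define T where "T i j \<omega> = Re (stop_coeff (\<lambda>i. Z i \<omega>) c s k i * cnj (stop_coeff (\<lambda>i. Z i \<omega>) c' s' l j)) * Z j \<omega> * Z i \<omega>" for i j \<omega>
  \<comment> \<open>Only the stopping rule of the sum up to \<open>l\<close> is kept, so the bound
    involves the threshold and maximum belonging to \<open>l\<close>.\<close>
  define U where "U j \<omega> = (if (\<Sum>i\<in>{j<..l}. (Z i \<omega>)\<^sup>2) \<le> c' then (Z j \<omega>)\<^sup>2 else 0)" for j \<omega>
  have T_int: "integrable M (T i j)" if "1 \<le> i" "1 \<le> j" for i j
    unfolding T_def[abs_def] using that by (rule integrable_cross_term)
  have T_0: "expectation (T i j) = 0" if "1 \<le> i" "1 \<le> j" "i \<noteq> j" for i j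
    unfolding T_def[abs_def] using that by (rule expectation_cross_term)
  have U_int: "integrable M (U j)" if "j \<in> {1..l}" for j
  proof (rule Bochner_Integration.integrable_bound[OF Z_square_integrable[of j]])
    have [measurable]: "i \<in> insert j {j<..l} \<Longrightarrow> Z i \<in> borel_measurable M" for i
      using that by (intro measurable_Z) auto
    show "U j \<in> borel_measurable M" unfolding U_def[abs_def] by measurable
  qed (use that in \<open>auto simp: U_def\<close>)
  have ptw: "s * s' * T j j \<omega> \<le> \<bar>s * s'\<bar> * ?K * U j \<omega>" for j \<omega>
  proof (cases "(\<Sum>i\<in>{j<..l}. (Z i \<omega>)\<^sup>2) \<le> c'")
    case True
    have "\<bar>Re (stop_coeff (\<lambda>i. Z i \<omega>) c s k j * cnj (stop_coeff (\<lambda>i. Z i \<omega>) c' s' l j))\<bar> \<le> ?K"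
      by (rule order.trans[OF abs_Re_le_cmod])
        (simp add: norm_mult norm_stop_coeff_le mult_mono)
    then have "\<bar>Re (stop_coeff (\<lambda>i. Z i \<omega>) c s k j * cnj (stop_coeff (\<lambda>i. Z i \<omega>) c' s' l j))\<bar> * (Z j \<omega>)\<^sup>2
        \<le> ?K * (Z j \<omega>)\<^sup>2"
      by (rule mult_right_mono) simp
    then have "\<bar>T j j \<omega>\<bar> \<le> ?K * (Z j \<omega>)\<^sup>2"
      by (simp only: T_def abs_mult mult.assoc power2_eq_square abs_mult_self_eq)
    then have "\<bar>s * s'\<bar> * \<bar>T j j \<omega>\<bar> \<le> \<bar>s * s'\<bar> * (?K * (Z j \<omega>)\<^sup>2)"
      by (intro mult_left_mono) auto
    with True show ?thesis
      using abs_ge_self[of "s * s' * T j j \<omega>"] by (simp add: U_def abs_mult mult.assoc)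
  qed (simp add: T_def U_def stop_coeff_def)
  have "expectation (\<lambda>\<omega>. Re (stopped_sum (\<lambda>i. Z i \<omega>) c s k * cnj (stopped_sum (\<lambda>i. Z i \<omega>) c' s' l)))
      = (\<Sum>i=1..k. \<Sum>j=1..l. s * s' * expectation (T i j))"
    unfolding Re_stopped_sum_mult T_def[symmetric] using T_int
    by (subst Bochner_Integration.integral_sum)
      (auto intro!: sum.cong simp: Bochner_Integration.integral_sum Bochner_Integration.integrable_sum)
  \<comment> \<open>The off-diagonal expectations vanish. With \<open>j\<close> outermost, each
    inner sum has at most one term, present exactly when \<open>j \<le> k\<close>.\<close>
  also have "\<dots> = (\<Sum>j=1..l. \<Sum>i=1..k. if i = j then s * s' * expectation (T j j) else 0)"
    by (subst sum.swap, intro sum.cong refl)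
      (auto simp: T_0)
  also have "\<dots> = (\<Sum>j=1..l. if j \<le> k then expectation (\<lambda>\<omega>. s * s' * T j j \<omega>) else 0)"
    by (intro sum.cong refl) auto
  also have "\<dots> \<le> (\<Sum>j=1..l. expectation (\<lambda>\<omega>. \<bar>s * s'\<bar> * ?K * U j \<omega>))"
  proof (rule sum_mono)
    fix j assume j: "j \<in> {1..l}"
    have "expectation (\<lambda>\<omega>. s * s' * T j j \<omega>) \<le> expectation (\<lambda>\<omega>. \<bar>s * s'\<bar> * ?K * U j \<omega>)"
      using j by (intro integral_mono ptw Bochner_Integration.integrable_mult_right T_int U_int) auto
    moreover have "0 \<le> expectation (\<lambda>\<omega>. \<bar>s * s'\<bar> * ?K * U j \<omega>)"
      by (intro Bochner_Integration.integral_nonneg) (auto simp: U_def)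
    ultimately show "(if j \<le> k then expectation (\<lambda>\<omega>. s * s' * T j j \<omega>) else 0)
        \<le> expectation (\<lambda>\<omega>. \<bar>s * s'\<bar> * ?K * U j \<omega>)"
      by simp
  qed
  also have "\<dots> = \<bar>s * s'\<bar> * ?K * expectation (\<lambda>\<omega>. \<Sum>j=1..l. U j \<omega>)"
    using U_int by (subst Bochner_Integration.integral_sum) (auto simp: sum_distrib_left)
  also have "\<dots> \<le> \<bar>s * s'\<bar> * ?K * expectation (\<lambda>\<omega>. c' + (MAX j\<in>{1..l}. \<bar>Z j \<omega>\<bar>\<^sup>2))"
  proof (intro mult_left_mono integral_mono)
    show "(\<Sum>j=1..l. U j \<omega>) \<le> c' + (MAX j\<in>{1..l}. \<bar>Z j \<omega>\<bar>\<^sup>2)" for \<omega>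
      unfolding U_def using assms by (intro sum_unstopped_squares_le) auto
  qed (use U_int integrable_Max_square[OF assms(1)] in auto)
  also have "expectation (\<lambda>\<omega>. c' + (MAX j\<in>{1..l}. \<bar>Z j \<omega>\<bar>\<^sup>2)) = c' + expectation (\<lambda>\<omega>. MAX j\<in>{1..l}. \<bar>Z j \<omega>\<bar>\<^sup>2)"
    using integrable_Max_square[OF assms(1)] by (simp add: prob_space)
  finally show ?thesis .
qed

end

section \<open>Weak convergence of weighted Dirac averages\<close>

lemma weak_conv_m_offset:
  "weak_conv_m (\<lambda>n. \<mu> (n + N)) \<nu> \<longleftrightarrow> weak_conv_m \<mu> \<nu>"
proof -
  have "(\<lambda>n. cdf (\<mu> (n + N)) x) \<longlonglongrightarrow> cdf \<nu> x \<longleftrightarrow> (\<lambda>n. cdf (\<mu> n) x) \<longlonglongrightarrow> cdf \<nu> x" for x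
    by (rule iffI[OF LIMSEQ_offset LIMSEQ_ignore_initial_segment])
  then show ?thesis
    by (simp only: weak_conv_m_def weak_conv_def)
qed

text \<open>Initial weights may all vanish, which makes the first measures zero; a shift of the
  index leaves only probability measures and does not affect limits.\<close>

lemma weighted_dirac_average_offset:
  assumes b: "\<And>k. k \<ge> 1 \<Longrightarrow> b k \<ge> 0"
    and D: "filterlim (\<lambda>n. \<Sum>k=1..n. b k) at_top sequentially"
  obtains N where "\<And>n. (\<Sum>k=1..n + N. b k) > 0"
    "\<And>x n. real_distribution (weighted_dirac_average b x (n + N))"
proof -
  have "\<forall>\<^sub>F n in sequentially. (\<Sum>k=1..n. b k) > 0"
    using D by (simp add: filterlim_at_top_dense)
  then obtain N where "\<And>n. n \<ge> N \<Longrightarrow> (\<Sum>k=1..n. b k) > 0"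
    by (auto simp: eventually_sequentially)
  then have "(\<Sum>k=1..n + N. b k) > 0" for n by simp
  with that show thesis
    using real_distribution_weighted_dirac_average b by blast
qed

lemma weak_conv_weighted_dirac_averageI:
  assumes b: "\<And>k. k \<ge> 1 \<Longrightarrow> b k \<ge> 0"
    and D: "filterlim (\<lambda>n. \<Sum>k=1..n. b k) at_top sequentially"
    and \<nu>: "real_distribution \<nu>"
    and conv: "AE t in lborel. weighted_average b (\<lambda>k. iexp (t * x k)) \<longlonglongrightarrow> char \<nu> t"
  shows "weak_conv_m (weighted_dirac_average b x) \<nu>"
proof -
  obtain N where N: "\<And>n. (\<Sum>k=1..n + N. b k) > 0"
    "\<And>x n. real_distribution (weighted_dirac_average b x (n + N))"
    using weighted_dirac_average_offset[OF b D] by metis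
  have char: "char (weighted_dirac_average b x (n + N)) t = weighted_average b (\<lambda>k. iexp (t * x k)) (n + N)" for n t
    unfolding char_def by (rule integral_weighted_dirac_average[OF N(1) b]) auto
  have "weak_conv_m (\<lambda>n. weighted_dirac_average b x (n + N)) \<nu>"
  proof (rule levy_continuity_AE[OF N(2) \<nu>])
    show "AE t in lborel. (\<lambda>n. char (weighted_dirac_average b x (n + N)) t) \<longlonglongrightarrow> char \<nu> t"
      using conv unfolding char by eventually_elim (rule LIMSEQ_ignore_initial_segment)
  qed
  then show ?thesis by (simp only: weak_conv_m_offset)
qed

lemma weak_conv_weighted_dirac_averageD:
  fixes f :: "real \<Rightarrow> real"
  assumes b: "\<And>k. k \<ge> 1 \<Longrightarrow> b k \<ge> 0"
    and D: "filterlim (\<lambda>n. \<Sum>k=1..n. b k) at_top sequentially"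
    and \<nu>: "real_distribution \<nu>"
    and conv: "weak_conv_m (weighted_dirac_average b x) \<nu>"
    and f: "\<And>y. isCont f y" "\<And>y. \<bar>f y\<bar> \<le> L"
  shows "weighted_average b (\<lambda>k. f (x k)) \<longlonglongrightarrow> integral\<^sup>L \<nu> f"
proof -
  obtain N where N: "\<And>n. (\<Sum>k=1..n + N. b k) > 0"
    "\<And>x n. real_distribution (weighted_dirac_average b x (n + N))"
    using weighted_dirac_average_offset[OF b D] by metis
  have [measurable]: "f \<in> borel_measurable borel"
    using f(1) by (intro borel_measurable_continuous_onI) (auto intro: continuous_at_imp_continuous_on)
  have "(\<lambda>n. integral\<^sup>L (weighted_dirac_average b x (n + N)) f) \<longlonglongrightarrow> integral\<^sup>L \<nu> f"
    using conv f by (intro weak_conv_imp_integral_bdd_continuous_conv[OF N(2) \<nu>]) (auto simp: weak_conv_m_offset)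
  also have "(\<lambda>n. integral\<^sup>L (weighted_dirac_average b x (n + N)) f) = (\<lambda>n. weighted_average b (\<lambda>k. f (x k)) (n + N))"
    by (intro ext integral_weighted_dirac_average N(1) b) auto
  finally show ?thesis by (rule LIMSEQ_offset)
qed

text \<open>For large \<open>l\<close> the growth condition bounds \<open>b l * B l\<close> by a
  multiple of \<open>B l - B (l - 1)\<close>, and these differences telescope. The finite initial
  part is absorbed using \<open>B k \<ge> B 1\<close>.\<close>

lemma sum_weights_le:
  fixes B b :: "nat \<Rightarrow> real"
  assumes B: "\<And>n. n \<ge> 1 \<Longrightarrow> B n > 0" "mono_on {1..} B"
    and b: "\<And>k. k \<ge> 1 \<Longrightarrow> b k \<ge> 0" "b \<in> O(\<lambda>k. (B k - B (k - 1)) / B k)"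
  obtains H where "H \<ge> 0" "\<And>k. k \<ge> 1 \<Longrightarrow> (\<Sum>l=1..k. b l * B l) \<le> H * B k"
proof -
  obtain c N' where c: "c > 0" and "\<And>k. k \<ge> N' \<Longrightarrow> norm (b k) \<le> c * norm ((B k - B (k - 1)) / B k)"
    using b(2) by (elim landau_o.bigE) (auto simp: eventually_sequentially)
  \<comment> \<open>With \<open>N \<ge> 1\<close> the increment bound is used only from index
    \<open>2\<close> on, so the unconstrained value \<open>B 0\<close> never enters.\<close>
  then obtain N where N: "N \<ge> 1" "\<And>k. k \<ge> N \<Longrightarrow> norm (b k) \<le> c * norm ((B k - B (k - 1)) / B k)"
    by (metis max.bounded_iff max.cobounded2)
  have mono: "B i \<le> B j" if "1 \<le> i" "i \<le> j" for i j
    using that B(2) by (auto simp: mono_on_def)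
  define S where "S = (\<Sum>l=1..N. b l * B l)"
  have S: "S \<ge> 0"
    unfolding S_def using less_imp_le[OF B(1)] b(1) by (intro sum_nonneg) simp
  have "(\<Sum>l=1..k. b l * B l) \<le> S + c * B k" if "k \<ge> 1" for k
  proof (cases "k \<le> N")
    case True
    have "(\<Sum>l=1..k. b l * B l) \<le> S"
      unfolding S_def using True less_imp_le[OF B(1)] b(1) by (intro sum_mono2) auto
    also have "\<dots> \<le> S + c * B k" using c B(1)[OF that] by simp
    finally show ?thesis .
  next
    case False
    then have "N \<le> k" by simp
    then show ?thesis
    proof (induction k rule: dec_induct)
      case base
      show ?case using c B(1)[OF N(1)] by (simp add: S_def)
    next
      case (step k)
      have k: "k \<ge> 1" using step N by simp
      have "b (Suc k) * B (Suc k) \<le> c * (B (Suc k) - B k)"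
        using N(2)[of "Suc k"] step b(1)[of "Suc k"] B(1)[of "Suc k"] mono[of k "Suc k"] k
        by (simp add: field_simps)
      with step.IH show ?case by (simp add: algebra_simps)
    qed
  qed
  moreover have "S + c * B k \<le> (S / B 1 + c) * B k" if "k \<ge> 1" for k
  proof -
    have "S * 1 \<le> S * (B k / B 1)"
      using S mono[OF _ that] B(1)[of 1] by (intro mult_left_mono) auto
    then show ?thesis by (simp add: algebra_simps)
  qed
  ultimately show thesis
    using S c B(1)[of 1] by (intro that[of "S / B 1 + c"]) (auto intro: order.trans)
qed

context reverse_martingale_differences
begin

text \<open>Expand the square into covariances. For \<open>l \<le> k\<close> a pair costs at most a
  constant times \<open>b k * b l * B l / B k\<close>, and summing over \<open>l\<close> with the
  bound \<open>H\<close> leaves a multiple of \<open>b k\<close>.\<close>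

lemma second_moment_weighted_stopped_sums:
  fixes B b :: "nat \<Rightarrow> real" and A C t :: real
  assumes B: "\<And>n. n \<ge> 1 \<Longrightarrow> B n > 0"
    and b: "\<And>k. k \<ge> 1 \<Longrightarrow> b k \<ge> 0"
    and H: "H \<ge> 0" "\<And>k. k \<ge> 1 \<Longrightarrow> (\<Sum>l=1..k. b l * B l) \<le> H * B k"
    and A: "A \<ge> 0"
    and C: "\<And>k. k \<ge> 1 \<Longrightarrow> expectation (\<lambda>\<omega>. (MAX j\<in>{1..k}. \<bar>Z j \<omega>\<bar>\<^sup>2)) \<le> C * (B k)\<^sup>2"
  defines "Y \<equiv> \<lambda>k \<omega>. stopped_sum (\<lambda>i. Z i \<omega>) (A * (B k)\<^sup>2) (t / B k) k"
  shows "integrable M (\<lambda>\<omega>. (cmod (\<Sum>k=1..n. b k *\<^sub>R Y k \<omega>))\<^sup>2)"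
    and "expectation (\<lambda>\<omega>. (cmod (\<Sum>k=1..n. b k *\<^sub>R Y k \<omega>))\<^sup>2)
      \<le> 2 * (t\<^sup>2 * exp (t\<^sup>2 * A) * (A + C)) * H * (\<Sum>k=1..n. b k)"
proof -
  define K where "K = t\<^sup>2 * exp (t\<^sup>2 * A) * (A + C)"
  have "0 \<le> expectation (\<lambda>\<omega>. (MAX j\<in>{1..1}. \<bar>Z j \<omega>\<bar>\<^sup>2))"
    by (intro Bochner_Integration.integral_nonneg) simp
  also note C[of 1]
  finally have "C \<ge> 0" using B[of 1] by (simp add: zero_le_mult_iff)
  then have K: "K \<ge> 0" using A by (simp add: K_def)
  define G where "G k l \<omega> = Re (Y k \<omega> * cnj (Y l \<omega>))" for k l \<omega>
  have G_int: "integrable M (G k l)" for k l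
    unfolding G_def[abs_def] Y_def by (rule integrable_stopped_sum_mult)
  have G_sym: "G k l = G l k" for k l
    by (simp add: G_def fun_eq_iff algebra_simps)
  have cov: "expectation (G k l) \<le> K * (B l / B k)" if "k \<ge> 1" "l \<ge> 1" for k l
  proof -
    have Bk: "B k > 0" and Bl: "B l > 0" using B that by auto
    \<comment> \<open>The scale \<open>t / B i\<close> and the threshold
      \<open>A * (B i)\<^sup>2\<close> cancel, so the exponential factors do not depend on the
      index.\<close>
    have e: "(t / B i)\<^sup>2 * (A * (B i)\<^sup>2) / 2 = t\<^sup>2 * A / 2" if "B i > 0" for i
      using that by (simp add: power_divide)
    have "expectation (G k l) \<le> \<bar>t / B k * (t / B l)\<bar> * (exp (t\<^sup>2 * A / 2) * exp (t\<^sup>2 * A / 2)) *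
        (A * (B l)\<^sup>2 + expectation (\<lambda>\<omega>. MAX j\<in>{1..l}. \<bar>Z j \<omega>\<bar>\<^sup>2))"
      using covariance_stopped_sum_le[OF that(2), of "A * (B l)\<^sup>2" "A * (B k)\<^sup>2" "t / B k" k "t / B l"] A
      unfolding e[OF Bk] e[OF Bl] by (simp add: G_def[abs_def] Y_def)
    also have "\<dots> \<le> \<bar>t / B k * (t / B l)\<bar> * (exp (t\<^sup>2 * A / 2) * exp (t\<^sup>2 * A / 2)) * (A * (B l)\<^sup>2 + C * (B l)\<^sup>2)"
      using C[OF that(2)] by (intro mult_left_mono) auto
    also have "exp (t\<^sup>2 * A / 2) * exp (t\<^sup>2 * A / 2) = exp (t\<^sup>2 * A)"
      by (simp add: exp_add[symmetric])
    also have "\<bar>t / B k * (t / B l)\<bar> * exp (t\<^sup>2 * A) * (A * (B l)\<^sup>2 + C * (B l)\<^sup>2) = K * (B l / B k)"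
      using Bk Bl by (simp add: K_def abs_mult abs_divide power2_eq_square field_simps)
    finally show ?thesis .
  qed
  have sq: "(cmod (\<Sum>k=1..n. b k *\<^sub>R Y k \<omega>))\<^sup>2 = (\<Sum>k=1..n. \<Sum>l=1..n. b k * b l * G k l \<omega>)" for \<omega>
  proof -
    have "(cmod (\<Sum>k=1..n. b k *\<^sub>R Y k \<omega>))\<^sup>2 = Re ((\<Sum>k=1..n. b k *\<^sub>R Y k \<omega>) * cnj (\<Sum>l=1..n. b l *\<^sub>R Y l \<omega>))"
      by (simp only: complex_norm_square[symmetric] Re_complex_of_real)
    also have "\<dots> = (\<Sum>k=1..n. \<Sum>l=1..n. b k * b l * G k l \<omega>)"
      unfolding cnj_sum sum_product Re_sum
      by (intro sum.cong refl) (simp add: G_def algebra_simps)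
    finally show ?thesis .
  qed
  show "integrable M (\<lambda>\<omega>. (cmod (\<Sum>k=1..n. b k *\<^sub>R Y k \<omega>))\<^sup>2)"
    unfolding sq by (intro Bochner_Integration.integrable_sum Bochner_Integration.integrable_mult_right G_int)
  \<comment> \<open>The lower triangle only: the covariance bound is summable in this order.
    Symmetrising counts the diagonal twice, which is harmless as \<open>g\<close> is nonnegative,
    and produces the constant \<open>2\<close>.\<close>
  define g where "g k l = (if l \<le> k then b k * b l * (K * (B l / B k)) else 0)" for k l
  have g0: "g k l \<ge> 0" if "k \<ge> 1" "l \<ge> 1" for k l
    using that K b less_imp_le[OF B] by (simp add: g_def)
  have "expectation (\<lambda>\<omega>. (cmod (\<Sum>k=1..n. b k *\<^sub>R Y k \<omega>))\<^sup>2) = (\<Sum>k=1..n. \<Sum>l=1..n. b k * b l * expectation (G k l))"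
    unfolding sq using G_int by (simp add: Bochner_Integration.integral_sum Bochner_Integration.integrable_sum)
  also have "\<dots> \<le> (\<Sum>k=1..n. \<Sum>l=1..n. g k l + g l k)"
  proof (intro sum_mono)
    fix k l assume "k \<in> {1..n}" "l \<in> {1..n}"
    then have kl: "k \<ge> 1" "l \<ge> 1" by auto
    have bb: "b k * b l \<ge> 0" using b kl by simp
    show "b k * b l * expectation (G k l) \<le> g k l + g l k"
    proof (cases "l \<le> k")
      case True
      then have "b k * b l * expectation (G k l) \<le> g k l"
        unfolding g_def using mult_left_mono[OF cov[OF kl] bb] by simp
      then show ?thesis using g0[OF kl(2,1)] by simp
    next
      case False
      then have "b k * b l * expectation (G k l) \<le> g l k"
        unfolding g_def using mult_left_mono[OF cov[OF kl(2,1)] bb] G_sym[of k l]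
        by (simp add: mult.commute)
      then show ?thesis using g0[OF kl] by simp
    qed
  qed
  also have "\<dots> = 2 * (\<Sum>k=1..n. \<Sum>l=1..n. g k l)"
    using sum.swap[of "\<lambda>k l. g l k" "{1..n}" "{1..n}"] by (simp add: sum.distrib)
  also have "\<dots> \<le> 2 * (\<Sum>k=1..n. K * H * b k)"
  proof (intro mult_left_mono sum_mono)
    fix k assume k: "k \<in> {1..n}"
    have "(\<Sum>l=1..n. g k l) = (\<Sum>l=1..k. b k * b l * (K * (B l / B k)))"
      unfolding g_def using k by (intro sum.mono_neutral_cong_right) auto
    also have "\<dots> = K * b k / B k * (\<Sum>l=1..k. b l * B l)"
      unfolding sum_distrib_left by (intro sum.cong refl) (simp add: field_simps)
    also have "\<dots> \<le> K * b k / B k * (H * B k)"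
      using k K b less_imp_le[OF B] by (intro mult_left_mono H) auto
    also have "\<dots> = K * H * b k" using B[of k] k by (simp add: field_simps)
    finally show "(\<Sum>l=1..n. g k l) \<le> K * H * b k" .
  qed simp
  also have "\<dots> = 2 * K * H * (\<Sum>k=1..n. b k)"
    by (simp add: sum_distrib_left mult_ac)
  finally show "expectation (\<lambda>\<omega>. (cmod (\<Sum>k=1..n. b k *\<^sub>R Y k \<omega>))\<^sup>2)
      \<le> 2 * (t\<^sup>2 * exp (t\<^sup>2 * A) * (A + C)) * H * (\<Sum>k=1..n. b k)"
    by (simp add: K_def)
qed

end

text \<open>By monotonicity of \<open>B\<close>, each \<open>(z j)\<^sup>2\<close> with
  \<open>j \<le> k\<close> is at most \<open>d\<^sup>2 * (B k)\<^sup>2\<close>, so the overshoot is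
  of the same order as the threshold.\<close>

lemma norm_normalized_stopped_sum_le:
  assumes B: "\<And>n. n \<ge> 1 \<Longrightarrow> B n > 0" "mono_on {1..} B"
    and d: "\<And>j. j \<ge> 1 \<Longrightarrow> \<bar>z j / B j\<bar> \<le> d" and "A \<ge> 0" "k \<ge> 1"
  shows "cmod (1 + stopped_sum z (A * (B k)\<^sup>2) (t / B k) k) \<le> exp (t\<^sup>2 * (A + d\<^sup>2) / 2)"
proof -
  have "(z j)\<^sup>2 \<le> d\<^sup>2 * (B k)\<^sup>2" if "j \<in> {1..k}" for j
  proof -
    have "\<bar>z j\<bar> \<le> d * B j"
      using d[of j] B(1)[of j] that by (simp add: abs_divide divide_le_eq)
    also have "\<dots> \<le> d * B k"
      using order.trans[OF abs_ge_zero d[of j]] B(2) that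
      by (intro mult_left_mono) (auto simp: mono_on_def)
    finally have "\<bar>z j\<bar>\<^sup>2 \<le> (d * B k)\<^sup>2" by (intro power_mono) auto
    then show ?thesis by (simp add: power_mult_distrib)
  qed
  then have "cmod (1 + stopped_sum z (A * (B k)\<^sup>2) (t / B k) k) \<le>
      exp ((t / B k)\<^sup>2 * (A * (B k)\<^sup>2 + d\<^sup>2 * (B k)\<^sup>2) / 2)"
    using assms by (intro norm_stopped_sum_le) auto
  also have "(t / B k)\<^sup>2 * (A * (B k)\<^sup>2 + d\<^sup>2 * (B k)\<^sup>2) = t\<^sup>2 * (A + d\<^sup>2)"
    using B(1)[OF assms(5)] by (simp add: power_divide field_simps)
  finally show ?thesis .
qed

lemma normalized_LIMSEQ_0_bounded:
  fixes z B :: "nat \<Rightarrow> real"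
  assumes "(\<lambda>n. z n / B n) \<longlonglongrightarrow> 0"
  obtains d where "\<And>j. \<bar>z j / B j\<bar> \<le> d"
  using convergent_imp_Bseq[OF convergentI[OF assms]] unfolding Bseq_def real_norm_def by blast

context reverse_martingale_differences
begin

text \<open>The strong law applies: its moment bound is the preceding estimate, and its random path
  bound comes from the boundedness of the convergent sequence \<open>Z n / B n\<close>.\<close>

lemma weighted_average_stopped_sums_LIMSEQ:
  fixes B b :: "nat \<Rightarrow> real" and A t :: real
  assumes B: "\<And>n. n \<ge> 1 \<Longrightarrow> B n > 0" "mono_on {1..} B"
    and b: "\<And>k. k \<ge> 1 \<Longrightarrow> b k \<ge> 0" "b \<in> O(\<lambda>k. (B k - B (k - 1)) / B k)"
    and D: "filterlim (\<lambda>n. \<Sum>k=1..n. b k) at_top sequentially"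
    and ZB: "AE \<omega> in M. (\<lambda>n. Z n \<omega> / B n) \<longlonglongrightarrow> 0"
    and C: "bdd_above ((\<lambda>k. \<integral>\<omega>. (MAX j\<in>{1..k}. \<bar>Z j \<omega>\<bar>\<^sup>2) / (B k)\<^sup>2 \<partial>M) ` {1..})"
    and A: "A \<ge> 0"
  shows "AE \<omega> in M. weighted_average b
    (\<lambda>k. stopped_sum (\<lambda>i. Z i \<omega>) (A * (B k)\<^sup>2) (t / B k) k) \<longlonglongrightarrow> 0"
proof -
  obtain H where H: "H \<ge> 0" "\<And>k. k \<ge> 1 \<Longrightarrow> (\<Sum>l=1..k. b l * B l) \<le> H * B k"
    using sum_weights_le[OF B b] by metis
  obtain C' where "\<And>k. k \<ge> 1 \<Longrightarrow> (\<integral>\<omega>. (MAX j\<in>{1..k}. \<bar>Z j \<omega>\<bar>\<^sup>2) / (B k)\<^sup>2 \<partial>M) \<le> C'"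
    using C unfolding bdd_above_def by auto
  then have C': "expectation (\<lambda>\<omega>. (MAX j\<in>{1..k}. \<bar>Z j \<omega>\<bar>\<^sup>2)) \<le> C' * (B k)\<^sup>2" if "k \<ge> 1" for k
    using that B(1)[OF that] by (simp add: divide_le_eq)
  show ?thesis
  proof (rule strong_law_weighted_average[OF b(1) D stopped_sum_measurable
        second_moment_weighted_stopped_sums[OF B(1) b(1) H A C']])
    show "AE \<omega> in M. \<exists>L. \<forall>k\<ge>1. cmod (stopped_sum (\<lambda>i. Z i \<omega>) (A * (B k)\<^sup>2) (t / B k) k) \<le> L"
      using ZB
    proof eventually_elim
      case (elim \<omega>)
      then obtain d where d: "\<And>j. \<bar>Z j \<omega> / B j\<bar> \<le> d"
        using normalized_LIMSEQ_0_bounded[of "\<lambda>n. Z n \<omega>" B] by blast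
      have "cmod (stopped_sum (\<lambda>i. Z i \<omega>) (A * (B k)\<^sup>2) (t / B k) k) \<le> exp (t\<^sup>2 * (A + d\<^sup>2) / 2) + 1"
        if "k \<ge> 1" for k
        using norm_normalized_stopped_sum_le[OF B d A that, of t]
          norm_triangle_ineq4[of "1 + stopped_sum (\<lambda>i. Z i \<omega>) (A * (B k)\<^sup>2) (t / B k) k" 1]
        by simp
      then show ?case by blast
    qed
  qed
qed

end

subsection \<open>Almost sure convergence of the characteristic functions\<close>

lemma weighted_average_add:
  "weighted_average b (\<lambda>k. f k + g k) n = weighted_average b f n + weighted_average b g n"
  by (simp add: weighted_average_def scaleR_add_right sum.distrib)

lemma weighted_average_mult_right:
  fixes f :: "nat \<Rightarrow> 'a::real_algebra"
  shows "weighted_average b (\<lambda>k. f k * c) n = weighted_average b f n * c"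
  by (simp add: weighted_average_def sum_distrib_right)

lemma weighted_average_const_LIMSEQ:
  assumes "filterlim (\<lambda>n. \<Sum>k=1..n. b k) at_top sequentially"
  shows "weighted_average b (\<lambda>k. c) \<longlonglongrightarrow> c"
proof (rule tendsto_eventually)
  have "\<forall>\<^sub>F n in sequentially. (\<Sum>k=1..n. b k) > 0"
    using assms by (simp add: filterlim_at_top_dense)
  then show "\<forall>\<^sub>F n in sequentially. weighted_average b (\<lambda>k. c) n = c"
    by eventually_elim (simp add: weighted_average_def scaleR_sum_left[symmetric])
qed

lemma abs_exp_minus_diff_le:
  fixes x y :: real
  assumes "x \<ge> 0" "y \<ge> 0"
  shows "\<bar>exp (- x) - exp (- y)\<bar> \<le> \<bar>x - y\<bar>"
proof -
  have *: "exp (- x) - exp (- y) \<le> y - x" if "0 \<le> x" "x \<le> y" for x y :: real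
  proof -
    have "exp (- x) - exp (- y) = exp (- x) * (1 - exp (- (y - x)))"
      by (simp add: algebra_simps exp_add[symmetric])
    also have "\<dots> \<le> 1 * (y - x)"
    proof (intro mult_mono)
      show "1 - exp (- (y - x)) \<le> y - x"
        using exp_ge_add_one_self[of "- (y - x)"] by linarith
    qed (use that in auto)
    finally show ?thesis by simp
  qed
  show ?thesis
  proof (cases "x \<le> y")
    case True
    with *[of x y] assms show ?thesis by simp
  next
    case False
    with *[of y x] assms show ?thesis by simp
  qed
qed

text \<open>For late \<open>j\<close> the bound at \<open>B j\<close> passes to \<open>B k\<close>
  by monotonicity; the finitely many early terms are swamped because \<open>B\<close>
  diverges.\<close>

lemma eventually_uniformly_small:
  fixes z B :: "nat \<Rightarrow> real"
  assumes B: "\<And>n. n \<ge> 1 \<Longrightarrow> B n > 0" "mono_on {1..} B" "filterlim B at_top sequentially"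
    and z: "(\<lambda>n. z n / B n) \<longlonglongrightarrow> 0" and \<mu>: "\<mu> > 0"
  shows "\<forall>\<^sub>F k in sequentially. \<forall>j\<in>{1..k}. \<bar>z j\<bar> \<le> \<mu> * B k"
proof -
  obtain N where N: "\<And>n. n \<ge> N \<Longrightarrow> \<bar>z n / B n\<bar> < \<mu>"
    using LIMSEQ_D[OF z \<mu>] by auto
  define S where "S = (\<Sum>j<N. \<bar>z j\<bar>)"
  have "\<forall>\<^sub>F k in sequentially. B k \<ge> S / \<mu>"
    using B(3) by (simp add: filterlim_at_top)
  then show ?thesis
  proof eventually_elim
    case (elim k)
    show ?case
    proof
      fix j assume j: "j \<in> {1..k}"
      show "\<bar>z j\<bar> \<le> \<mu> * B k"
      proof (cases "j < N")
        case True
        have "\<bar>z j\<bar> \<le> S"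
          unfolding S_def using True by (intro member_le_sum) auto
        also have "\<dots> \<le> \<mu> * B k"
          using elim \<mu> by (simp add: field_simps)
        finally show ?thesis .
      next
        case False
        then have "\<bar>z j\<bar> \<le> \<mu> * B j"
          using N[of j] B(1)[of j] j by (simp add: abs_divide divide_less_eq)
        also have "\<dots> \<le> \<mu> * B k"
          using B(2) j \<mu> by (intro mult_left_mono) (auto simp: mono_on_def)
        finally show ?thesis .
      qed
    qed
  qed
qed

text \<open>As \<open>v \<le> A\<close>, nothing is stopped. The first error is McLeish's, with the
  sum of cubes at most the largest entry times the sum of squares; the second comes from replacing
  \<open>v\<close> by \<open>\<zeta>\<close> in the Gaussian factor.\<close>

lemma unstopped_approximation:
  fixes z B :: "nat \<Rightarrow> real"
  assumes k: "k \<ge> 1" "B k > 0"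
    and small: "\<And>j. j \<in> {1..k} \<Longrightarrow> \<bar>z j\<bar> \<le> \<mu> * B k"
    and v: "v = (\<Sum>j=1..k. (z j)\<^sup>2) / (B k)\<^sup>2" "\<bar>v - \<zeta>\<bar> \<le> \<eta>" "v \<le> A" and \<zeta>: "\<zeta> \<ge> 0"
  shows "cmod (iexp (t * ((\<Sum>j=1..k. z j) / B k)) -
      (1 + stopped_sum z (A * (B k)\<^sup>2) (t / B k) k) * of_real (exp (- (t\<^sup>2 * \<zeta> / 2))))
    \<le> 2 * \<bar>t\<bar> ^ 3 * A * \<mu> + exp (t\<^sup>2 * A / 2) * t\<^sup>2 * \<eta>"
proof -
  define x where "x j = t / B k * z j" for j
  have V: "(\<Sum>j=1..k. (z j)\<^sup>2) = v * (B k)\<^sup>2" using v(1) k(2) by simp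
  have v0: "v \<ge> 0" unfolding v(1) by (simp add: sum_nonneg)
  have V_le: "(\<Sum>j=1..k. (z j)\<^sup>2) \<le> A * (B k)\<^sup>2"
    unfolding V by (intro mult_right_mono v) simp
  have \<mu>: "\<mu> \<ge> 0"
    using small[of 1] k zero_le_mult_iff[of \<mu> "B k"] order.trans[OF abs_ge_zero] by force
  have sum_x: "(\<Sum>j=1..k. x j) = t * ((\<Sum>j=1..k. z j) / B k)"
    unfolding x_def sum_distrib_left[symmetric] by simp
  have sum_x2: "(\<Sum>j=1..k. (x j)\<^sup>2) = t\<^sup>2 * v"
    unfolding x_def power_mult_distrib sum_distrib_left[symmetric] V using k(2) by (simp add: power_divide)
  have prod: "1 + stopped_sum z (A * (B k)\<^sup>2) (t / B k) k = (\<Prod>j=1..k. 1 + \<i> * x j)"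
    unfolding stopped_sum_unstopped[OF k(1) V_le] by (simp add: x_def)
  have cube: "\<bar>x j\<bar> ^ 3 \<le> \<bar>t\<bar> * \<mu> * (x j)\<^sup>2" if "j \<in> {1..k}" for j
  proof -
    have "\<bar>x j\<bar> = \<bar>t\<bar> * (\<bar>z j\<bar> / B k)"
      using k(2) by (simp add: x_def abs_mult)
    also have "\<dots> \<le> \<bar>t\<bar> * \<mu>"
      using small[OF that] k(2) by (intro mult_left_mono) (auto simp: divide_le_eq)
    finally have "\<bar>x j\<bar> * \<bar>x j\<bar>\<^sup>2 \<le> \<bar>t\<bar> * \<mu> * \<bar>x j\<bar>\<^sup>2"
      by (rule mult_right_mono) simp
    then show ?thesis by (simp add: power2_eq_square power3_eq_cube mult.assoc)
  qed
  have "(\<Sum>j=1..k. \<bar>x j\<bar> ^ 3) \<le> \<bar>t\<bar> * \<mu> * (t\<^sup>2 * v)"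
    unfolding sum_x2[symmetric] sum_distrib_left by (intro sum_mono cube)
  also have "\<dots> \<le> \<bar>t\<bar> * \<mu> * (t\<^sup>2 * A)"
    using v(3) \<mu> by (intro mult_left_mono) auto
  also have "\<dots> = \<bar>t\<bar> ^ 3 * A * \<mu>"
    by (simp add: power2_eq_square power3_eq_cube abs_mult_self_eq mult_ac)
  finally have E1: "cmod (iexp (\<Sum>j=1..k. x j) - (\<Prod>j=1..k. 1 + \<i> * x j) * of_real (exp (- (t\<^sup>2 * v / 2))))
      \<le> 2 * \<bar>t\<bar> ^ 3 * A * \<mu>"
    using iexp_sum_McLeish_bound[of "{1..k}" x, OF finite_atLeastAtMost] unfolding sum_x2 by linarith
  have "cmod (\<Prod>j=1..k. 1 + \<i> * x j) \<le> exp ((t / B k)\<^sup>2 * (A * (B k)\<^sup>2) / 2)"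
    using norm_prod_McLeish_le[OF V_le, of "t / B k"] by (simp add: x_def)
  also have "(t / B k)\<^sup>2 * (A * (B k)\<^sup>2) = t\<^sup>2 * A"
    using k(2) by (simp add: power_divide)
  finally have P: "cmod (\<Prod>j=1..k. 1 + \<i> * x j) \<le> exp (t\<^sup>2 * A / 2)" .
  have "\<bar>exp (- (t\<^sup>2 * v / 2)) - exp (- (t\<^sup>2 * \<zeta> / 2))\<bar> \<le> \<bar>t\<^sup>2 * v / 2 - t\<^sup>2 * \<zeta> / 2\<bar>"
    using v0 \<zeta> by (intro abs_exp_minus_diff_le) auto
  also have "\<dots> = t\<^sup>2 / 2 * \<bar>v - \<zeta>\<bar>"
    by (simp add: abs_mult diff_divide_distrib[symmetric] right_diff_distrib[symmetric])
  also have "\<dots> \<le> t\<^sup>2 * \<eta>"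
    using v(2) by (intro mult_mono) auto
  finally have E: "\<bar>exp (- (t\<^sup>2 * v / 2)) - exp (- (t\<^sup>2 * \<zeta> / 2))\<bar> \<le> t\<^sup>2 * \<eta>" .
  have E2: "cmod ((\<Prod>j=1..k. 1 + \<i> * x j) * of_real (exp (- (t\<^sup>2 * v / 2)) - exp (- (t\<^sup>2 * \<zeta> / 2))))
      \<le> exp (t\<^sup>2 * A / 2) * (t\<^sup>2 * \<eta>)"
    unfolding norm_mult norm_of_real by (intro mult_mono P E) auto
  have "iexp (\<Sum>j=1..k. x j) - (\<Prod>j=1..k. 1 + \<i> * x j) * of_real (exp (- (t\<^sup>2 * \<zeta> / 2))) =
      (iexp (\<Sum>j=1..k. x j) - (\<Prod>j=1..k. 1 + \<i> * x j) * of_real (exp (- (t\<^sup>2 * v / 2)))) +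
      (\<Prod>j=1..k. 1 + \<i> * x j) * of_real (exp (- (t\<^sup>2 * v / 2)) - exp (- (t\<^sup>2 * \<zeta> / 2)))"
    by (simp add: right_diff_distrib)
  then have "cmod (iexp (\<Sum>j=1..k. x j) - (\<Prod>j=1..k. 1 + \<i> * x j) * of_real (exp (- (t\<^sup>2 * \<zeta> / 2))))
      \<le> 2 * \<bar>t\<bar> ^ 3 * A * \<mu> + exp (t\<^sup>2 * A / 2) * (t\<^sup>2 * \<eta>)"
    using norm_triangle_mono[OF E1 E2] by (simp only:)
  then show ?thesis
    unfolding sum_x prod by (simp add: mult.assoc)
qed

text \<open>If the averaged \<open>min 1 \<bar>v\<^sub>k - \<zeta>\<bar>\<close> vanish, then the indices \<open>k\<close> with \<open>v\<^sub>k\<close> far from \<open>\<zeta>\<close> have density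
  zero, and the stopped products are bounded there.\<close>

lemma weighted_average_iexp_LIMSEQ:
  fixes z B b :: "nat \<Rightarrow> real"
  assumes B: "\<And>n. n \<ge> 1 \<Longrightarrow> B n > 0" "mono_on {1..} B" "filterlim B at_top sequentially"
    and b: "\<And>k. k \<ge> 1 \<Longrightarrow> b k \<ge> 0"
    and D: "filterlim (\<lambda>n. \<Sum>k=1..n. b k) at_top sequentially"
    and z: "(\<lambda>n. z n / B n) \<longlonglongrightarrow> 0"
    and \<zeta>: "\<zeta> \<ge> 0" "\<zeta> + 1 \<le> A"
    and v: "weighted_average b (\<lambda>k. min 1 \<bar>(\<Sum>j=1..k. (z j)\<^sup>2) / (B k)\<^sup>2 - \<zeta>\<bar>) \<longlonglongrightarrow> 0"
    and Y: "weighted_average b (\<lambda>k. stopped_sum z (A * (B k)\<^sup>2) (t / B k) k) \<longlonglongrightarrow> 0"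
  shows "weighted_average b (\<lambda>k. iexp (t * ((\<Sum>j=1..k. z j) / B k))) \<longlonglongrightarrow> of_real (exp (- (t\<^sup>2 * \<zeta> / 2)))"
proof -
  define E :: complex where "E = of_real (exp (- (t\<^sup>2 * \<zeta> / 2)))"
  define Y' where "Y' k = stopped_sum z (A * (B k)\<^sup>2) (t / B k) k" for k
  define \<delta> where "\<delta> k = iexp (t * ((\<Sum>j=1..k. z j) / B k)) - (1 + Y' k) * E" for k
  obtain d where d: "\<And>j. \<bar>z j / B j\<bar> \<le> d"
    using normalized_LIMSEQ_0_bounded[OF z] by blast
  have A: "A \<ge> 0" using \<zeta> by simp
  have E1: "cmod E \<le> 1" using \<zeta> by (simp add: E_def)
  have "weighted_average b (\<lambda>k. cmod (\<delta> k)) \<longlonglongrightarrow> 0"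
  proof (rule weighted_average_tendsto_0[OF b D _ v])
    fix k :: nat assume k: "k \<ge> 1"
    have "cmod (\<delta> k) \<le> 1 + cmod ((1 + Y' k) * E)"
      unfolding \<delta>_def by (rule order.trans[OF norm_triangle_ineq4]) simp
    also have "cmod ((1 + Y' k) * E) \<le> exp (t\<^sup>2 * (A + d\<^sup>2) / 2) * 1"
      unfolding norm_mult Y'_def
      by (intro mult_mono norm_normalized_stopped_sum_le[OF B(1,2) d A k] E1) auto
    finally show "cmod (\<delta> k) \<le> 1 + exp (t\<^sup>2 * (A + d\<^sup>2) / 2)" by simp
  next
    fix e :: real assume e: "e > 0"
    \<comment> \<open>Each of the two approximation errors becomes at most \<open>e / 2\<close>; the
      \<open>+ 1\<close> keeps the denominators positive when \<open>t = 0\<close>.\<close>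
    define \<mu> where "\<mu> = e / 2 / (2 * \<bar>t\<bar> ^ 3 * A + 1)"
    \<comment> \<open>The cap \<open>1 / 2\<close> makes the truncation by \<open>1\<close> inactive
      and keeps the normalised sum of squares below \<open>\<zeta> + 1 \<le> A\<close>.\<close>
    define \<eta> where "\<eta> = min (1 / 2) (e / 2 / (exp (t\<^sup>2 * A / 2) * t\<^sup>2 + 1))"
    have c1: "2 * \<bar>t\<bar> ^ 3 * A \<ge> 0" using A by simp
    have c2: "exp (t\<^sup>2 * A / 2) * t\<^sup>2 \<ge> 0" by simp
    have \<mu>: "\<mu> > 0" unfolding \<mu>_def using e c1 by (intro divide_pos_pos) linarith+
    have "\<eta> > 0"
      unfolding \<eta>_def min_less_iff_conj using e c2 by (intro conjI divide_pos_pos) linarith+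
    moreover have "\<eta> \<le> 1 / 2"
      unfolding \<eta>_def by (rule min.cobounded1)
    ultimately have \<eta>: "\<eta> > 0" "\<eta> \<le> 1 / 2" by auto
    have half: "c * (e / 2 / (c + 1)) \<le> e / 2" if "c \<ge> 0" for c
    proof -
      have "e / 2 * (c / (c + 1)) \<le> e / 2 * 1"
        using that e by (intro mult_left_mono) auto
      then show ?thesis by (simp add: mult_ac)
    qed
    have \<mu>': "2 * \<bar>t\<bar> ^ 3 * A * \<mu> \<le> e / 2"
      unfolding \<mu>_def using c1 by (rule half)
    have "exp (t\<^sup>2 * A / 2) * t\<^sup>2 * \<eta> \<le> exp (t\<^sup>2 * A / 2) * t\<^sup>2 * (e / 2 / (exp (t\<^sup>2 * A / 2) * t\<^sup>2 + 1))"
      using c2 unfolding \<eta>_def by (intro mult_left_mono min.cobounded2)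
    also have "\<dots> \<le> e / 2"
      using c2 by (rule half)
    finally have \<eta>': "exp (t\<^sup>2 * A / 2) * t\<^sup>2 * \<eta> \<le> e / 2" .
    obtain N where N: "\<And>k j. k \<ge> N \<Longrightarrow> j \<in> {1..k} \<Longrightarrow> \<bar>z j\<bar> \<le> \<mu> * B k"
      using eventually_uniformly_small[OF B z \<mu>] unfolding eventually_sequentially by blast
    show "\<exists>\<eta>>0. \<exists>N. \<forall>k\<ge>N. min 1 \<bar>(\<Sum>j=1..k. (z j)\<^sup>2) / (B k)\<^sup>2 - \<zeta>\<bar> < \<eta> \<longrightarrow> cmod (\<delta> k) \<le> e"
    proof (intro exI[of _ \<eta>] exI[of _ "max 1 N"] conjI allI impI \<eta>(1))
      fix k assume k: "max 1 N \<le> k" and lt: "min 1 \<bar>(\<Sum>j=1..k. (z j)\<^sup>2) / (B k)\<^sup>2 - \<zeta>\<bar> < \<eta>"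
      have close: "\<bar>(\<Sum>j=1..k. (z j)\<^sup>2) / (B k)\<^sup>2 - \<zeta>\<bar> \<le> \<eta>"
        using lt \<eta>(2) by linarith
      have "cmod (\<delta> k) \<le> 2 * \<bar>t\<bar> ^ 3 * A * \<mu> + exp (t\<^sup>2 * A / 2) * t\<^sup>2 * \<eta>"
        unfolding \<delta>_def Y'_def E_def
      proof (rule unstopped_approximation[where v = "(\<Sum>j=1..k. (z j)\<^sup>2) / (B k)\<^sup>2"])
        show "(\<Sum>j=1..k. (z j)\<^sup>2) / (B k)\<^sup>2 \<le> A"
          using close \<eta>(2) \<zeta> by linarith
      qed (use k B(1) N \<zeta> close in auto)
      then show "cmod (\<delta> k) \<le> e" using \<mu>' \<eta>' by linarith
    qed
  qed auto
  then have \<delta>0: "weighted_average b \<delta> \<longlonglongrightarrow> 0"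
    by (rule weighted_average_norm_tendsto_0[rotated]) (rule b)
  have "weighted_average b (\<lambda>k. 1 + Y' k) \<longlonglongrightarrow> 1 + 0"
    unfolding weighted_average_add Y'_def
    by (intro tendsto_add weighted_average_const_LIMSEQ[OF D] Y)
  then have "(\<lambda>n. weighted_average b \<delta> n + weighted_average b (\<lambda>k. 1 + Y' k) n * E) \<longlonglongrightarrow> 0 + (1 + 0) * E"
    by (intro tendsto_intros \<delta>0)
  moreover have "weighted_average b \<delta> n + weighted_average b (\<lambda>k. 1 + Y' k) n * E =
      weighted_average b (\<lambda>k. iexp (t * ((\<Sum>j=1..k. z j) / B k))) n" for n
    unfolding weighted_average_mult_right[symmetric] weighted_average_add[symmetric]
    by (simp add: \<delta>_def)
  ultimately show ?thesis by (simp add: E_def)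
qed

text \<open>Fubini exchanges the two almost-everywhere quantifiers, provided the set of convergence
  is jointly measurable.\<close>

lemma AE_lborel_LIMSEQ:
  fixes f :: "nat \<Rightarrow> 'a \<Rightarrow> real \<Rightarrow> complex"
  assumes "sigma_finite_measure M"
    and [measurable]: "\<And>n. (\<lambda>(\<omega>, t). f n \<omega> t) \<in> borel_measurable (M \<Otimes>\<^sub>M lborel)"
      "(\<lambda>(\<omega>, t). g \<omega> t) \<in> borel_measurable (M \<Otimes>\<^sub>M lborel)"
    and lim: "\<And>t. AE \<omega> in M. (\<lambda>n. f n \<omega> t) \<longlonglongrightarrow> g \<omega> t"
  shows "AE \<omega> in M. AE t in lborel. (\<lambda>n. f n \<omega> t) \<longlonglongrightarrow> g \<omega> t"
proof -
  interpret M: sigma_finite_measure M by fact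
  interpret pair_sigma_finite M lborel ..
  \<comment> \<open>Convergence is tested at tolerances \<open>inverse (real (Suc i))\<close>, so
    that only countable quantifiers remain.\<close>
  let ?P = "\<lambda>\<omega> t. \<forall>i. \<exists>N. \<forall>n\<ge>N. dist (f n \<omega> t) (g \<omega> t) < inverse (real (Suc i))"
  have P: "(\<lambda>n. f n \<omega> t) \<longlonglongrightarrow> g \<omega> t \<longleftrightarrow> ?P \<omega> t" for \<omega> t
    unfolding lim_sequentially
  proof safe
    fix e :: real assume all: "?P \<omega> t" and "e > 0"
    then obtain i where "inverse (real (Suc i)) < e" using reals_Archimedean by blast
    with all show "\<exists>N. \<forall>n\<ge>N. dist (f n \<omega> t) (g \<omega> t) < e" by (meson order.strict_trans)
  qed simp
  have "{x \<in> space (M \<Otimes>\<^sub>M lborel). (\<lambda>n. f n (fst x) (snd x)) \<longlonglongrightarrow> g (fst x) (snd x)} \<in> sets (M \<Otimes>\<^sub>M lborel)"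
    unfolding P by measurable
  from AE_commute[OF this] lim show ?thesis by auto
qed

theorem theorem8p1:
  fixes M :: "'a measure"
    and F :: "nat \<Rightarrow> 'a measure"
    and Z :: "nat \<Rightarrow> 'a \<Rightarrow> real"
    and B b :: "nat \<Rightarrow> real"
    and \<zeta> :: "'a \<Rightarrow> real"
  assumes "prob_space M"
    and "\<And>n. n \<ge> 1 \<Longrightarrow> subalgebra M (F n)"
    and "\<And>n. n \<ge> 1 \<Longrightarrow> subalgebra (F n) (F (Suc n))"
    and "\<And>n. n \<ge> 1 \<Longrightarrow> Z n \<in> borel_measurable (F n)"
    and "\<And>n. n \<ge> 1 \<Longrightarrow> integrable M (\<lambda>\<omega>. (Z n \<omega>)\<^sup>2)"
    and "\<And>n. n \<ge> 1 \<Longrightarrow> AE \<omega> in M. real_cond_exp M (F (Suc n)) (Z n) \<omega> = 0"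
    and "\<And>n. n \<ge> 1 \<Longrightarrow> B n > 0"
    and "mono_on {1..} B"
    and "filterlim B at_top sequentially"
    and "\<zeta> \<in> borel_measurable M"
    and "\<And>\<omega>. \<omega> \<in> space M \<Longrightarrow> \<zeta> \<omega> \<ge> 0"
    and "\<And>k. k \<ge> 1 \<Longrightarrow> b k \<ge> 0"
    and "bounded (b ` {1..})"
    and "filterlim (\<lambda>n. \<Sum>k=1..n. b k) at_top sequentially"
    and "AE \<omega> in M. (\<lambda>n. Z n \<omega> / B n) \<longlonglongrightarrow> 0"
    and "AE \<omega> in M. weak_conv_m
           (weighted_dirac_average b (\<lambda>k. (\<Sum>j=1..k. (Z j \<omega>)\<^sup>2) / (B k)\<^sup>2))
           (return borel (\<zeta> \<omega>))"
    and "b \<in> O(\<lambda>k. (B k - B (k - 1)) / B k)"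
    and "bdd_above ((\<lambda>k. \<integral>\<omega>. (MAX j\<in>{1..k}. \<bar>Z j \<omega>\<bar>\<^sup>2) / (B k)\<^sup>2 \<partial>M) ` {1..})"
  shows "AE \<omega> in M. weak_conv_m
           (weighted_dirac_average b (\<lambda>k. (\<Sum>j=1..k. Z j \<omega>) / B k))
           (centered_normal (\<zeta> \<omega>))"
proof -
  interpret prob_space M by fact
  interpret reverse_martingale_differences M F Z
    by standard (use assms in auto)
  note B = assms(7-9) and \<zeta>_nonneg = assms(11) and b = assms(12) and D = assms(14)
  note [measurable] = assms(10)
  \<comment> \<open>The bounded continuous function
    \<open>min 1 \<bar>y - \<zeta> \<omega>\<bar>\<close> vanishes at
    \<open>\<zeta> \<omega>\<close>, so its integral against the limiting Dirac mass is
    zero.\<close>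
  have AE_v: "AE \<omega> in M. weighted_average b (\<lambda>k. min 1 \<bar>(\<Sum>j=1..k. (Z j \<omega>)\<^sup>2) / (B k)\<^sup>2 - \<zeta> \<omega>\<bar>) \<longlonglongrightarrow> 0"
    using assms(16)
  proof eventually_elim
    case (elim \<omega>)
    have "real_distribution (return borel (\<zeta> \<omega>))"
      by (auto simp: real_distribution_def real_distribution_axioms_def intro: prob_space_return)
    moreover have "isCont (\<lambda>y. min 1 \<bar>y - \<zeta> \<omega>\<bar>) y" for y
      by (intro continuous_min continuous_intros)
    ultimately show ?case
      using weak_conv_weighted_dirac_averageD[OF b D _ elim, of "\<lambda>y. min 1 \<bar>y - \<zeta> \<omega>\<bar>" 1]
      by (simp add: integral_return)
  qed
  have AE_iexp: "AE \<omega> in M. weighted_average b (\<lambda>k. iexp (t * ((\<Sum>j=1..k. Z j \<omega>) / B k)))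
      \<longlonglongrightarrow> of_real (exp (- (t\<^sup>2 * \<zeta> \<omega> / 2)))" for t
  proof -
    \<comment> \<open>The stopping level must be deterministic while \<open>\<zeta>\<close> is
      random. Countably many levels share one exceptional set, and a level above
      \<open>\<zeta> \<omega> + 1\<close> is then chosen for each path.\<close>
    have "AE \<omega> in M. \<forall>A::nat. weighted_average b
        (\<lambda>k. stopped_sum (\<lambda>i. Z i \<omega>) (real A * (B k)\<^sup>2) (t / B k) k) \<longlonglongrightarrow> 0"
      unfolding AE_all_countable
      by (intro allI weighted_average_stopped_sums_LIMSEQ[OF B(1,2) b assms(17) D assms(15,18)]) simp_all
    with AE_v assms(15) AE_space show ?thesis
    proof eventually_elim
      case (elim \<omega>)
      obtain A :: nat where "\<zeta> \<omega> + 1 \<le> real A" using real_arch_simple by blast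
      with elim show ?case
        by (intro weighted_average_iexp_LIMSEQ[OF B b D]) (auto intro: \<zeta>_nonneg)
    qed
  qed
  \<comment> \<open>So far the exceptional event depends on \<open>t\<close>; after the exchange
    there is one event, outside which almost every \<open>t\<close> is good.\<close>
  have "AE \<omega> in M. AE t in lborel. weighted_average b (\<lambda>k. iexp (t * ((\<Sum>j=1..k. Z j \<omega>) / B k)))
      \<longlonglongrightarrow> of_real (exp (- (t\<^sup>2 * \<zeta> \<omega> / 2)))"
  proof (rule AE_lborel_LIMSEQ[OF sigma_finite_measure_axioms _ _ AE_iexp])
    have [measurable]: "(\<lambda>\<omega>. \<Sum>j=1..k. Z j \<omega>) \<in> borel_measurable M" for k
      by (intro borel_measurable_sum measurable_Z) simp
    show "(\<lambda>(\<omega>, t). weighted_average b (\<lambda>k. iexp (t * ((\<Sum>j=1..k. Z j \<omega>) / B k))) n)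
        \<in> borel_measurable (M \<Otimes>\<^sub>M lborel)" for n
      unfolding weighted_average_def by measurable
    show "(\<lambda>(\<omega>, t). complex_of_real (exp (- (t\<^sup>2 * \<zeta> \<omega> / 2)))) \<in> borel_measurable (M \<Otimes>\<^sub>M lborel)"
      by measurable
  qed
  with AE_space show ?thesis
  proof eventually_elim
    case (elim \<omega>)
    with \<zeta>_nonneg[OF elim(1)] show ?case
      by (intro weak_conv_weighted_dirac_averageI[OF b D real_distribution_centered_normal])
        (auto simp: char_centered_normal)
  qed
qed

end
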